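(* Let $\alpha>0$ and let $\mathcal{L}_\alpha$ be the Poisson process of loops of intensity $\alpha\mu$, with occupation field $\widehat{\mathcal{L}_\alpha}$. For every nonnegative measure $\chi=(\chi_x)_{x\in X}$ on $X$, $$\mathbb{E}\big(e^{-\langle\widehat{\mathcal{L}_\alpha},\chi\rangle}\big)=\det(I+GM_\chi)^{-\alpha}=\det(I-G_\chi M_\chi)^{\alpha}=\det(G_\chi G^{-1})^{\alpha},$$ where $\langle\widehat{\mathcal{L}_\alpha},\chi\rangle=\sum_x\widehat{\mathcal{L}_\alpha}^x\chi_x$, $M_\chi$ is the diagonal matrix with entries $\chi_x$, and $G_\chi=(M_\lambda+M_\chi-C)^{-1}$.
   Context: Setting. $X$ is a finite set; $C=(C_{x,y})_{x,y\in X}$ is a symmetric matrix with nonnegative entries and zero diagonal (conductances), irreducible; $\kappa=(\kappa_x)_{x\in X}$ is a nonnegative killing measure; $\lambda_x=\kappa_x+\sum_y C_{x,y}>0$; $M_\lambda$ is the diagonal matrix with entries $\lambda_x$. The symmetric matrix $M_\lambda-C$ is assumed positive definite (mass gap). The Green function is $G=(M_\lambda-C)^{-1}$. Loops. A based loop is a pair $(\xi,\tau^* )$ with $p\ge1$, $\xi=(\xi_i)_{i\in\mathbb{Z}/p\mathbb{Z}}\in X^p$ and $\tau^*=(\tau_i^* )_{i\in\mathbb{Z}/p\mathbb{Z}}\in(0,\infty)^p$ (intrinsic holding times). A loop $l$ is an equivalence class of based loops under cyclic rotation of the index. The loop measure $\mu$ is the image on loops of the measure on based loops which is $e^{-\lambda_x\tau^*}\frac{d\tau^*}{\tau^*}$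 on one-point (trivial) loops at $x$, for each $x\in X$, and, for $p\ge2$ and each $\xi\in X^p$, is $\frac1p\prod_{i\in\mathbb{Z}/p\mathbb{Z}}C_{\xi_i,\xi_{i+1}}e^{-\lambda_{\xi_i}\tau_i^*}d\tau_i^*$. The occupation field of a loop is $\widehat{l}^x=\sum_{i}1_{\{\xi_i=x\}}\tau_i^*$. $\mathcal{L}_\alpha$ is the Poisson point process on loops with intensity $\alpha\mu$, and $\widehat{\mathcal{L}_\alpha}^x=\sum_{l\in\mathcal{L}_\alpha}\widehat{l}^x$. *)

theory Defs
  imports "HOL-Probability.Probability"
begin

definition diag_mat :: "real^'n \<Rightarrow> real^'n^'n" where
  "diag_mat v = (\<chi> x y. if x = y then v $ x else 0)"

definition pos_def_mat :: "real^'n^'n \<Rightarrow> bool" where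
  "pos_def_mat A \<longleftrightarrow> transpose A = A \<and> (\<forall>v. v \<noteq> 0 \<longrightarrow> v \<bullet> (A *v v) > 0)"

(* Irreducibility of a nonnegative matrix: its graph is strongly connected. The reflexive closure
   admits the one-point space with zero conductance. *)
definition irreducible_mat :: "real^'n^'n \<Rightarrow> bool" where
  "irreducible_mat C \<longleftrightarrow> (\<forall>x y. (x, y) \<in> {(u, v). C $ u $ v > 0}\<^sup>*)"

definition lam :: "real^'n^'n \<Rightarrow> real^'n \<Rightarrow> real^'n" where
  "lam C \<kappa> = (\<chi> x. \<kappa> $ x + (\<Sum>y\<in>UNIV. C $ x $ y))"

definition green :: "real^'n^'n \<Rightarrow> real^'n \<Rightarrow> real^'n^'n" where
  "green C \<kappa> = matrix_inv (diag_mat (lam C \<kappa>) - C)"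

definition green_pert :: "real^'n^'n \<Rightarrow> real^'n \<Rightarrow> real^'n \<Rightarrow> real^'n^'n" where
  "green_pert C \<kappa> v = matrix_inv (diag_mat (lam C \<kappa>) + diag_mat v - C)"

(* The index set Z/pZ is represented by the positions 0, ..., p - 1 of two lists of length p. *)
type_synonym 'n based_loop = "'n list \<times> real list"
type_synonym 'n loop = "'n based_loop set"

definition based_loops :: "'n based_loop set" where
  "based_loops = {(xi, t). xi \<noteq> [] \<and> length t = length xi \<and> (\<forall>s\<in>set t. 0 < s)}"

definition rotation_rel :: "('n based_loop \<times> 'n based_loop) set" where
  "rotation_rel = {((xi, t), (xi', t')).
     (xi, t) \<in> based_loops \<and> (\<exists>k. xi' = rotate k xi \<and> t' = rotate k t)}"

definition loop_of :: "'n based_loop \<Rightarrow> 'n loop" where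
  "loop_of b = rotation_rel `` {b}"

definition loops :: "'n loop set" where
  "loops = based_loops // rotation_rel"

lemma equiv_rotation_rel: "equiv (based_loops :: 'n based_loop set) rotation_rel" (is "equiv ?B ?r")
proof (rule equivI)
  show "?r \<subseteq> ?B \<times> ?B"
    by (auto simp: rotation_rel_def based_loops_def)
  show "refl_on ?B ?r"
    unfolding refl_on_def rotation_rel_def
    by (auto intro: exI[of _ 0])
  show "sym ?r"
  proof (rule symI)
    fix a b :: "'n based_loop"
    assume "(a, b) \<in> ?r"
    then obtain xi t k where a: "a = (xi, t)" and b: "b = (rotate k xi, rotate k t)"
      and al: "a \<in> based_loops"
      by (auto simp: rotation_rel_def)
    let ?n = "length xi"
    have n: "?n > 0" "length t = ?n" using al a by (auto simp: based_loops_def)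
    define j where "j = ?n - k mod ?n"
    have "(j + k) mod ?n = (j + k mod ?n) mod ?n" by (simp add: mod_add_right_eq)
    also have "j + k mod ?n = ?n" using n by (simp add: j_def less_imp_le)
    finally have "(j + k) mod ?n = 0" by simp
    then have "rotate (j + k) xi = xi" "rotate (j + k) t = t"
      using n(2) by (simp_all add: rotate_id)
    then have "xi = rotate j (rotate k xi)" "t = rotate j (rotate k t)"
      by (simp_all add: rotate_rotate)
    moreover have "b \<in> based_loops" using al a b by (auto simp: based_loops_def)
    ultimately show "(b, a) \<in> ?r"
      unfolding rotation_rel_def a b by blast
  qed
  show "trans ?r"
    by (rule transI) (force simp: rotation_rel_def rotate_rotate)
qed

(* A set of based loops restricted to the skeleton xi, seen as a set of holding times. *)
definition slice :: "'n list \<Rightarrow> 'n based_loop set \<Rightarrow> (nat \<Rightarrow> real) set" where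
  "slice xi A = {t \<in> extensional {..<length xi}. (xi, map t [0..<length xi]) \<in> A}"

abbreviation times :: "'n list \<Rightarrow> (nat \<Rightarrow> real) measure" where
  "times xi \<equiv> Pi\<^sub>M {..<length xi} (\<lambda>_. lborel)"

definition loop_density :: "real^'n^'n \<Rightarrow> real^'n \<Rightarrow> 'n list \<Rightarrow> (nat \<Rightarrow> real) \<Rightarrow> real" where
  "loop_density C \<kappa> xi t =
     (let p = length xi in
      if p = 1 then exp (- (lam C \<kappa> $ (xi ! 0)) * t 0) / t 0
      else 1 / real p *
        (\<Prod>i<p. C $ (xi ! i) $ (xi ! ((i + 1) mod p)) * exp (- (lam C \<kappa> $ (xi ! i)) * t i)))"

(* The disjoint union, over skeletons, of the Borel structures of the spaces of holding times. *)
definition based_loop_sets :: "'n based_loop set set" where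
  "based_loop_sets = {A. A \<subseteq> based_loops \<and> (\<forall>xi. xi \<noteq> [] \<longrightarrow> slice xi A \<in> sets (times xi))}"

(* Positivity of the holding times is carried by the space, hence absent from the density. *)
definition based_loop_measure :: "real^'n^'n \<Rightarrow> real^'n \<Rightarrow> 'n based_loop measure" where
  "based_loop_measure C \<kappa> = measure_of based_loops based_loop_sets
     (\<lambda>A. \<integral>\<^sup>+xi. emeasure (density (times xi) (\<lambda>t. ennreal (loop_density C \<kappa> xi t))) (slice xi A)
           \<partial>count_space {xi. xi \<noteq> []})"

definition loop_sets :: "'n loop set set" where
  "loop_sets = {A. A \<subseteq> loops \<and> loop_of -` A \<inter> based_loops \<in> based_loop_sets}"

definition loop_measure :: "real^'n^'n \<Rightarrow> real^'n \<Rightarrow> 'n loop measure" where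
  "loop_measure C \<kappa> = distr (based_loop_measure C \<kappa>) (sigma loops loop_sets) (loop_of)"

lemma slice_UN: "slice xi (\<Union>i. A i) = (\<Union>i. slice xi (A i))"
  by (auto simp: slice_def)

lemma slice_Diff: "slice xi (A - B) = slice xi A - slice xi B"
  by (auto simp: slice_def)

lemma slice_based_loops:
  assumes "xi \<noteq> []"
  shows "slice xi based_loops = (\<Pi>\<^sub>E i\<in>{..<length xi}. {0<..})"
  using assms by (auto simp: slice_def based_loops_def PiE_def Pi_def)

lemma sigma_algebra_based_loop_sets: "sigma_algebra based_loops based_loop_sets"
  unfolding sigma_algebra_iff2
proof (intro conjI ballI allI impI)
  show "based_loop_sets \<subseteq> Pow based_loops" by (auto simp: based_loop_sets_def)
  show "{} \<in> based_loop_sets" by (auto simp: based_loop_sets_def slice_def)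
next
  fix A :: "'a based_loop set" assume A: "A \<in> based_loop_sets"
  have "slice xi (based_loops - A) \<in> sets (times xi)" if "xi \<noteq> []" for xi
  proof -
    have "slice xi based_loops \<in> sets (times xi)"
      unfolding slice_based_loops[OF that] by (rule sets_PiM_I_finite) auto
    then show ?thesis using A that by (auto simp: slice_Diff based_loop_sets_def)
  qed
  then show "based_loops - A \<in> based_loop_sets" by (auto simp: based_loop_sets_def)
next
  fix A :: "nat \<Rightarrow> 'a based_loop set" assume "range A \<subseteq> based_loop_sets"
  then show "(\<Union>i. A i) \<in> based_loop_sets"
    unfolding based_loop_sets_def slice_UN by (fastforce simp: slice_UN)
qed

lemma space_based_loop_measure [simp]: "space (based_loop_measure C \<kappa>) = based_loops"
  unfolding based_loop_measure_def
  by (rule space_measure_of) (auto simp: based_loop_sets_def)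

lemma sets_based_loop_measure [simp]: "sets (based_loop_measure C \<kappa>) = based_loop_sets"
  unfolding based_loop_measure_def
  by (rule sigma_algebra.sets_measure_of_eq[OF sigma_algebra_based_loop_sets])

lemma emeasure_based_loop_measure:
  assumes "A \<in> based_loop_sets"
  shows "emeasure (based_loop_measure C \<kappa>) A =
    (\<integral>\<^sup>+xi. emeasure (density (times xi) (\<lambda>t. ennreal (loop_density C \<kappa> xi t))) (slice xi A)
      \<partial>count_space {xi. xi \<noteq> []})"
  unfolding based_loop_measure_def
proof (rule emeasure_measure_of_sigma[OF sigma_algebra_based_loop_sets _ _ assms])
  let ?f = "\<lambda>A xi. emeasure (density (times xi) (\<lambda>t. ennreal (loop_density C \<kappa> xi t))) (slice xi A)"
  let ?N = "count_space {xi. xi \<noteq> []}"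
  show "positive based_loop_sets (\<lambda>A. \<integral>\<^sup>+xi. ?f A xi \<partial>?N)"
    by (simp add: positive_def slice_def)
  show "countably_additive based_loop_sets (\<lambda>A. \<integral>\<^sup>+xi. ?f A xi \<partial>?N)"
    unfolding countably_additive_def
  proof (intro allI impI)
    fix A :: "nat \<Rightarrow> 'a based_loop set"
    assume A: "range A \<subseteq> based_loop_sets" and d: "disjoint_family A"
    have "(\<Sum>i. \<integral>\<^sup>+xi. ?f (A i) xi \<partial>?N) = (\<integral>\<^sup>+xi. (\<Sum>i. ?f (A i) xi) \<partial>?N)"
      by (rule nn_integral_suminf[symmetric]) simp
    also have "\<dots> = (\<integral>\<^sup>+xi. ?f (\<Union>i. A i) xi \<partial>?N)"
    proof (rule nn_integral_cong)
      fix xi :: "'a list" assume "xi \<in> space ?N"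
      then have xi: "xi \<noteq> []" by simp
      show "(\<Sum>i. ?f (A i) xi) = ?f (\<Union>i. A i) xi"
        unfolding slice_UN
      proof (rule suminf_emeasure)
        show "range (\<lambda>i. slice xi (A i)) \<subseteq>
            sets (density (times xi) (\<lambda>t. ennreal (loop_density C \<kappa> xi t)))"
          using A xi by (auto simp: based_loop_sets_def)
        show "disjoint_family (\<lambda>i. slice xi (A i))"
          using d by (auto simp: disjoint_family_on_def slice_def)
      qed
    qed
    finally show "(\<Sum>i. \<integral>\<^sup>+xi. ?f (A i) xi \<partial>?N) = (\<integral>\<^sup>+xi. ?f (\<Union>i. A i) xi \<partial>?N)" .
  qed
qed

lemma sigma_algebra_loop_sets: "sigma_algebra loops loop_sets"
proof -
  interpret B: sigma_algebra based_loops based_loop_sets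
    by (rule sigma_algebra_based_loop_sets)
  have p: "loop_of \<in> based_loops \<rightarrow> loops"
    by (auto simp: loops_def loop_of_def quotient_def)
  show ?thesis
    unfolding sigma_algebra_iff2
  proof (intro conjI ballI allI impI)
    show "loop_sets \<subseteq> Pow loops" by (auto simp: loop_sets_def)
    show "{} \<in> loop_sets" by (auto simp: loop_sets_def)
  next
    fix A :: "'a loop set" assume A: "A \<in> loop_sets"
    have "loop_of -` (loops - A) \<inter> based_loops =
        based_loops - (loop_of -` A \<inter> based_loops)"
      using p by auto
    then show "loops - A \<in> loop_sets" using A by (auto simp: loop_sets_def)
  next
    fix A :: "nat \<Rightarrow> 'a loop set" assume A: "range A \<subseteq> loop_sets"
    have "loop_of -` (\<Union>i. A i) \<inter> based_loops =
        (\<Union>i. loop_of -` A i \<inter> based_loops)"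
      by auto
    moreover have "\<dots> \<in> based_loop_sets"
      using A by (intro B.countable_UN) (auto simp: loop_sets_def)
    ultimately show "(\<Union>i. A i) \<in> loop_sets" using A by (auto simp: loop_sets_def)
  qed
qed

lemma space_loop_measure [simp]: "space (loop_measure C \<kappa>) = loops"
  unfolding loop_measure_def by (simp add: space_measure_of_conv)

lemma sets_loop_measure [simp]: "sets (loop_measure C \<kappa>) = loop_sets"
  unfolding loop_measure_def
  by (simp add: sigma_algebra.sets_measure_of_eq[OF sigma_algebra_loop_sets])

lemma measurable_loop_of:
  "loop_of \<in> based_loop_measure C \<kappa> \<rightarrow>\<^sub>M sigma loops loop_sets"
proof (rule measurable_sigma_sets)
  show "sets (sigma loops loop_sets) = sigma_sets loops loop_sets"
    by (rule sets_measure_of) (auto simp: loop_sets_def)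
qed (auto simp: loop_sets_def loops_def loop_of_def quotient_def)

lemma emeasure_loop_measure:
  assumes "A \<in> loop_sets"
  shows "emeasure (loop_measure C \<kappa>) A =
    emeasure (based_loop_measure C \<kappa>) (loop_of -` A \<inter> based_loops)"
  unfolding loop_measure_def
  using assms emeasure_distr[OF measurable_loop_of, of A C \<kappa>]
  by (simp add: sigma_algebra.sets_measure_of_eq[OF sigma_algebra_loop_sets])

definition based_occ :: "'n based_loop \<Rightarrow> 'n \<Rightarrow> real" where
  "based_occ b x = (\<Sum>i<length (fst b). if fst b ! i = x then snd b ! i else 0)"

(* The common value of based_occ on the representatives of a loop, cf. occ_loop_of below. *)
definition occ :: "'n loop \<Rightarrow> 'n \<Rightarrow> real" where
  "occ l x = the_elem ((\<lambda>b. based_occ b x) ` l)"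

lemma based_occ_rotation:
  assumes "(b, b') \<in> rotation_rel"
  shows "based_occ b' x = based_occ b x"
proof -
  have sl: "based_occ (xi, t) x = (\<Sum>(y, s)\<leftarrow>zip xi t. if y = x then s else 0)"
    if "length t = length xi" for xi t
    using that by (simp add: based_occ_def sum_list_sum_nth atLeast0LessThan cong: if_cong)
  obtain xi t k where b: "b = (xi, t)" "b' = (rotate k xi, rotate k t)" "length t = length xi"
    "xi \<noteq> []"
    using assms by (auto simp: rotation_rel_def based_loops_def)
  have z: "zip (rotate k xi) (rotate k t) = rotate k (zip xi t)"
    by (rule nth_equalityI) (use b(3,4) in \<open>auto simp: nth_rotate\<close>)
  have "sum_list (map f (rotate k ys)) = sum_list (map f ys)"
    for f :: "'a \<times> real \<Rightarrow> real" and ys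
  proof -
    let ?m = "k mod length ys"
    have "sum_list (map f (rotate k ys)) =
        sum_list (map f (take ?m ys)) + sum_list (map f (drop ?m ys))"
      by (simp add: rotate_drop_take)
    also have "\<dots> = sum_list (map f (take ?m ys @ drop ?m ys))"
      by (simp only: map_append sum_list_append)
    finally show ?thesis by simp
  qed
  then show ?thesis using b z by (simp add: sl)
qed

lemma occ_loop_of:
  assumes "b \<in> based_loops"
  shows "occ (loop_of b) x = based_occ b x"
proof -
  have "b \<in> loop_of b"
    using equiv_class_self[OF equiv_rotation_rel assms] by (simp add: loop_of_def)
  moreover have "based_occ b' x = based_occ b x" if "b' \<in> loop_of b" for b'
    using that based_occ_rotation[of b b' x] by (simp add: loop_of_def)
  ultimately have "(\<lambda>b. based_occ b x) ` loop_of b = {based_occ b x}" by blast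
  then show ?thesis by (simp add: occ_def)
qed

(* A point configuration is given by the multiplicity of each point. *)
definition occ_field :: "('n loop \<Rightarrow> nat) \<Rightarrow> 'n \<Rightarrow> ennreal" where
  "occ_field m x = (\<integral>\<^sup>+l. of_nat (m l) * ennreal (occ l x) \<partial>count_space UNIV)"

definition pairing :: "('n::finite \<Rightarrow> ennreal) \<Rightarrow> real^'n \<Rightarrow> ennreal" where
  "pairing f v = (\<Sum>x\<in>UNIV. f x * ennreal (v $ x))"

(* The occupation field takes values in [0, infinity]; exp_neg sends infinity to 0. *)
definition exp_neg :: "ennreal \<Rightarrow> real" where
  "exp_neg a = (if a = \<infinity> then 0 else exp (- enn2real a))"

(* num_points m is the counting measure of the configuration m. In poisson_point_process, a set of
   infinite intensity carries infinitely many points almost surely. *)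
definition num_points :: "('l \<Rightarrow> nat) \<Rightarrow> 'l set \<Rightarrow> ennreal" where
  "num_points m A = (\<integral>\<^sup>+l. of_nat (m l) \<partial>count_space A)"

definition poisson_point_process :: "'w measure \<Rightarrow> 'l measure \<Rightarrow> ('w \<Rightarrow> 'l \<Rightarrow> nat) \<Rightarrow> bool" where
  "poisson_point_process P \<nu> N \<longleftrightarrow>
     prob_space P \<and>
     (\<forall>\<omega>\<in>space P. \<forall>l. l \<notin> space \<nu> \<longrightarrow> N \<omega> l = 0) \<and>
     (\<forall>A\<in>sets \<nu>. (\<lambda>\<omega>. num_points (N \<omega>) A) \<in> borel_measurable P) \<and>
     (\<forall>A\<in>sets \<nu>. emeasure \<nu> A < \<infinity> \<longrightarrow>
        (\<forall>k. measure P {\<omega>\<in>space P. num_points (N \<omega>) A = of_nat k} =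
             exp (- measure \<nu> A) * measure \<nu> A ^ k / fact k)) \<and>
     (\<forall>A\<in>sets \<nu>. emeasure \<nu> A = \<infinity> \<longrightarrow> (AE \<omega> in P. num_points (N \<omega>) A = \<infinity>)) \<and>
     (\<forall>(n::nat) A. (\<forall>i<n. A i \<in> sets \<nu>) \<longrightarrow> disjoint_family_on A {..<n} \<longrightarrow>
        prob_space.indep_vars P (\<lambda>_. borel) (\<lambda>i \<omega>. num_points (N \<omega>) (A i)) {..<n})"

end

theory Submission
  imports Defs
begin

text \<open>
  For a Poisson point process of intensity \<open>\<nu>\<close> and a nonnegative function \<open>f\<close>, the sum of \<open>f\<close> over
  the points has Laplace transform \<open>exp (- \<integral> (1 - exp (- f)) d\<nu>)\<close>. Pairing the occupation field with
  \<open>\<chi>\<close> is such a sum, for the function \<open>f l = \<Sum>\<^sub>x occ l x * \<chi>\<^sub>x\<close> on loops, so everything rests on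
  the integral of \<open>1 - exp (- f)\<close> against the loop measure \<open>\<mu>\<close>.

  That integral splits over skeletons, and on a fixed skeleton the holding times are independent.
  A one-point loop at \<open>x\<close> contributes a Frullani integral, equal to \<open>ln ((\<lambda>\<^sub>x + \<chi>\<^sub>x) / \<lambda>\<^sub>x)\<close>.
  For a skeleton of length \<open>p \<ge> 2\<close> the exponential integrals turn the product of conductances into
  cyclic products of the matrices \<open>A = M\<^sub>\<lambda>\<^sup>-\<^sup>1 C\<close> and \<open>B = (M\<^sub>\<lambda> + M\<^sub>\<chi>)\<^sup>-\<^sup>1 C\<close>, and the
  sum over all skeletons of length \<open>p\<close> is \<open>(tr A\<^sup>p - tr B\<^sup>p) / p\<close>. As the diagonal of \<open>C\<close> vanishes,
  this expression is \<open>0\<close> at \<open>p = 1\<close> and may be summed from there. Now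
  \<open>det (1 - A) = exp (- \<Sum>\<^sub>p tr A\<^sup>p / p)\<close>; after multiplication by the determinants of the
  diagonal matrices the logarithms from the one-point loops are absorbed, and
  \<open>\<integral> (1 - exp (- f)) d\<mu> = ln (det (M\<^sub>\<lambda> + M\<^sub>\<chi> - C) / det (M\<^sub>\<lambda> - C))\<close>. The three determinants
  of the theorem are this ratio or its inverse.

  The trace expansion needs the powers of \<open>A\<close> to decay geometrically, and here the mass gap enters.
  A positive definite matrix with nonpositive off-diagonal entries has a monotone inverse, so
  \<open>(M\<^sub>\<lambda> - C) u = \<lambda>\<close> has a solution \<open>u \<ge> 0\<close>. It satisfies \<open>A u = u - 1\<close>, which makes \<open>A\<close> a strict
  contraction in the supremum norm weighted by \<open>u\<close>. The same applies to \<open>B\<close>, because adding \<open>M\<^sub>\<chi>\<close>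
  preserves positive definiteness.

  The proof of the theorem combines \<open>poisson_point_process_laplace\<close> with
  \<open>loop_measure_laplace_exponent\<close>; the latter rests on \<open>det_diag_minus_eq_exp_trace\<close>,
  \<open>sum_cyclic_prod_eq_trace\<close> and the integrals over single skeletons.
\<close>

section \<open>The Laplace functional of a Poisson point process\<close>

lemma exp_neg_nonneg [simp]: "0 \<le> exp_neg a"
  and exp_neg_le_one [simp]: "exp_neg a \<le> 1"
  by (auto simp: exp_neg_def)

lemma exp_neg_top [simp]: "exp_neg top = 0"
  and exp_neg_zero [simp]: "exp_neg 0 = 1"
  and exp_neg_ennreal: "0 \<le> r \<Longrightarrow> exp_neg (ennreal r) = exp (- r)"
  by (auto simp: exp_neg_def)

lemma exp_neg_add: "exp_neg (a + b) = exp_neg a * exp_neg b"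
  by (cases a; cases b) (auto simp: exp_neg_ennreal exp_add[symmetric] simp flip: ennreal_plus)

lemma exp_neg_sum: "exp_neg (\<Sum>i\<in>I. f i) = (\<Prod>i\<in>I. exp_neg (f i))"
  by (induction I rule: infinite_finite_induct) (auto simp: exp_neg_add)

lemma exp_neg_antimono: "a \<le> b \<Longrightarrow> exp_neg b \<le> exp_neg a"
  by (cases a; cases b) (auto simp: exp_neg_ennreal top_unique)

lemma measurable_exp_neg [measurable]: "exp_neg \<in> borel_measurable borel"
  unfolding exp_neg_def[abs_def] by measurable

text \<open>
  Along increasing sequences \<open>exp_neg\<close> is continuous even at \<open>\<infinity>\<close>. This is what lets the Laplace
  functional pass from simple functions to arbitrary ones.
\<close>
lemma LIMSEQ_exp_neg_SUP:
  assumes "incseq F"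
  shows "(\<lambda>i. exp_neg (F i)) \<longlonglongrightarrow> exp_neg (SUP i. F i)"
proof -
  have lim: "F \<longlonglongrightarrow> (SUP i. F i)" by (rule LIMSEQ_SUP[OF assms])
  show ?thesis
  proof (cases "SUP i. F i")
    case (real r)
    have fin: "F i \<noteq> \<infinity>" for i
      using SUP_upper[of i UNIV F] real by (auto simp: top_unique)
    have "(\<lambda>i. enn2real (F i)) \<longlonglongrightarrow> r"
      by (rule tendsto_enn2real) (use lim real in simp_all)
    then have "(\<lambda>i. exp (- enn2real (F i))) \<longlonglongrightarrow> exp (- r)"
      by (intro tendsto_exp tendsto_minus)
    then show ?thesis using real fin by (simp add: exp_neg_def)
  next
    case top
    show ?thesis
    proof (rule LIMSEQ_I)
      fix e :: real assume e: "0 < e"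
      \<comment> \<open>Any \<open>K \<ge> 0\<close> with \<open>exp (- K) < e\<close> would do.\<close>
      define K where "K = max 0 (1 - ln e)"
      have "ennreal K < (SUP i. F i)" unfolding top by simp
      then have "eventually (\<lambda>i. ennreal K < F i) sequentially"
        by (rule order_tendstoD(1)[OF lim])
      then obtain n where n: "\<And>i. i \<ge> n \<Longrightarrow> ennreal K < F i"
        by (auto simp: eventually_sequentially)
      have "norm (exp_neg (F i) - exp_neg (SUP i. F i)) < e" if "i \<ge> n" for i
      proof -
        have "exp_neg (F i) \<le> exp_neg (ennreal K)"
          by (rule exp_neg_antimono) (use n[OF that] in simp)
        also have "\<dots> = exp (- K)" by (rule exp_neg_ennreal) (simp add: K_def)
        also have "\<dots> < exp (ln e)" by (simp add: K_def)
        also have "\<dots> = e" using e by simp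
        finally show ?thesis unfolding top by simp
      qed
      then show "\<exists>n. \<forall>i\<ge>n. norm (exp_neg (F i) - exp_neg (SUP i. F i)) < e" by blast
    qed
  qed
qed

text \<open>
  The exponential series. The variable \<open>N\<close> takes values in \<open>[0, \<infinity>]\<close>, but the Poisson weights
  already sum to \<open>1\<close>, so almost surely it is a natural number.
\<close>
lemma nn_integral_exp_neg_poisson:
  fixes N :: "'w \<Rightarrow> ennreal"
  assumes P: "prob_space P" and N [measurable]: "N \<in> borel_measurable P" and v: "0 \<le> v"
    and pois: "\<And>k. measure P {\<omega>\<in>space P. N \<omega> = of_nat k} = exp (- v) * v ^ k / fact k"
    and c: "0 \<le> c"
  shows "(\<integral>\<^sup>+\<omega>. ennreal (exp_neg (ennreal c * N \<omega>)) \<partial>P) = ennreal (exp (- ((1 - exp (- c)) * v)))"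
proof -
  interpret prob_space P by (rule P)
  define Q where "Q k = {\<omega>\<in>space P. N \<omega> = of_nat k}" for k :: nat
  have Q [measurable]: "Q k \<in> sets P" for k unfolding Q_def by measurable
  have mQ: "emeasure P (Q k) = ennreal (exp (- v) * v ^ k / fact k)" for k
    using pois[of k] by (simp add: Q_def emeasure_eq_measure)
  have disj: "disjoint_family Q"
    by (auto simp: disjoint_family_on_def Q_def)
  have ser: "(\<lambda>k. exp (- v) * (q * v) ^ k / fact k) sums exp (- ((1 - q) * v))" for q :: real
  proof -
    have "(\<lambda>k. exp (- v) * ((q * v) ^ k /\<^sub>R fact k)) sums (exp (- v) * exp (q * v))"
      by (intro sums_mult exp_converges)
    then show ?thesis by (simp add: exp_add[symmetric] algebra_simps divide_inverse)
  qed
  have nat: "AE \<omega> in P. \<omega> \<in> (\<Union>k. Q k)"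
  proof (rule AE_prob_1)
    have "emeasure P (\<Union>k. Q k) = (\<Sum>k. emeasure P (Q k))"
      using disj by (intro suminf_emeasure[symmetric]) auto
    also have "\<dots> = ennreal 1"
      unfolding mQ using ser[of 1] v by (intro suminf_ennreal_eq) auto
    finally show "prob (\<Union>k. Q k) = 1" by (simp add: measure_def)
  qed
  have "(\<integral>\<^sup>+\<omega>. ennreal (exp_neg (ennreal c * N \<omega>)) \<partial>P) =
      (\<integral>\<^sup>+\<omega>. (\<Sum>k. ennreal (exp (- c) ^ k) * indicator (Q k) \<omega>) \<partial>P)"
  proof (rule nn_integral_cong_AE, use nat in eventually_elim)
    fix \<omega> assume "\<omega> \<in> (\<Union>k. Q k)"
    then obtain k where k: "\<omega> \<in> Q k" by auto
    have "(\<Sum>j. ennreal (exp (- c) ^ j) * indicator (Q j) \<omega>) =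
        (\<Sum>j\<in>{k}. ennreal (exp (- c) ^ j) * indicator (Q j) \<omega>)"
      using k disj by (intro suminf_finite) (auto simp: disjoint_family_on_def split: split_indicator)
    also have "\<dots> = ennreal (exp_neg (ennreal c * N \<omega>))"
    proof -
      have "ennreal c * N \<omega> = ennreal (c * real k)"
        using k c by (simp add: Q_def ennreal_mult ennreal_of_nat_eq_real_of_nat)
      then show ?thesis
        using k c by (simp add: exp_neg_ennreal exp_of_nat_mult[symmetric] mult_ac)
    qed
    finally show "ennreal (exp_neg (ennreal c * N \<omega>)) = (\<Sum>j. ennreal (exp (- c) ^ j) * indicator (Q j) \<omega>)" ..
  qed
  also have "\<dots> = (\<Sum>k. \<integral>\<^sup>+\<omega>. ennreal (exp (- c) ^ k) * indicator (Q k) \<omega> \<partial>P)"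
    by (rule nn_integral_suminf) measurable
  also have "\<dots> = (\<Sum>k. ennreal (exp (- v) * (exp (- c) * v) ^ k / fact k))"
    using v by (simp add: nn_integral_cmult_indicator mQ ennreal_mult[symmetric] power_mult_distrib)
      (simp add: mult_ac)
  also have "\<dots> = ennreal (exp (- ((1 - exp (- c)) * v)))"
    using ser[of "exp (- c)"] v by (intro suminf_ennreal_eq) auto
  finally show ?thesis .
qed

text \<open>
  If \<open>A\<close> has infinite intensity, it carries infinitely many points and both sides vanish,
  unless \<open>c = 0\<close>, when \<open>0 * \<infinity> = 0\<close> makes both equal to \<open>1\<close>.
\<close>
lemma poisson_point_process_laplace_set:
  assumes ppp: "poisson_point_process P \<nu> N" and A: "A \<in> sets \<nu>" and c: "c < top"
  shows "(\<integral>\<^sup>+\<omega>. ennreal (exp_neg (c * num_points (N \<omega>) A)) \<partial>P)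
    = ennreal (exp_neg (ennreal (1 - exp_neg c) * emeasure \<nu> A))"
proof -
  interpret prob_space P using ppp by (simp add: poisson_point_process_def)
  obtain r where r: "0 \<le> r" "c = ennreal r" using c by (cases c) auto
  show ?thesis
  proof (cases "emeasure \<nu> A = \<infinity>")
    case False
    then have fin: "emeasure \<nu> A < \<infinity>" by (simp add: less_top)
    have "(\<integral>\<^sup>+\<omega>. ennreal (exp_neg (ennreal r * num_points (N \<omega>) A)) \<partial>P)
        = ennreal (exp (- ((1 - exp (- r)) * measure \<nu> A)))"
      by (rule nn_integral_exp_neg_poisson)
        (use ppp A fin r in \<open>auto simp: poisson_point_process_def\<close>)
    also have "\<dots> = ennreal (exp_neg (ennreal ((1 - exp (- r)) * measure \<nu> A)))"
      using r by (subst exp_neg_ennreal) auto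
    finally show ?thesis
      using r False by (simp add: exp_neg_ennreal emeasure_eq_ennreal_measure ennreal_mult)
  next
    case True
    show ?thesis
    proof (cases "r = 0")
      case True
      then show ?thesis using r by (simp add: emeasure_space_1)
    next
      case False
      then have r0: "0 < r" using r by simp
      have "AE \<omega> in P. num_points (N \<omega>) A = \<infinity>"
        using ppp A True by (simp add: poisson_point_process_def)
      then have "AE \<omega> in P. ennreal (exp_neg (c * num_points (N \<omega>) A)) = 0"
        by eventually_elim (use r0 r in \<open>simp add: ennreal_mult_top\<close>)
      then have "(\<integral>\<^sup>+\<omega>. ennreal (exp_neg (c * num_points (N \<omega>) A)) \<partial>P) = (\<integral>\<^sup>+\<omega>. 0 \<partial>P)"
        by (rule nn_integral_cong_AE)
      then show ?thesis using True r0 r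
        by (simp add: exp_neg_ennreal ennreal_mult_top)
    qed
  qed
qed

text \<open>
  The level sets of a simple function turn both the sum over the points and the integral
  against the intensity into finite sums. The level sets are disjoint, hence their numbers of points are
  independent. They are indexed by an initial segment of the natural numbers because that is how
  independence is phrased in \<open>poisson_point_process\<close>.
\<close>
lemma poisson_point_process_simple_sums:
  assumes ppp: "poisson_point_process P \<nu> N" and g: "simple_function \<nu> g"
  obtains n h A where "\<And>i. i < n \<Longrightarrow> h i \<in> g ` space \<nu>" "\<And>i. i < (n::nat) \<Longrightarrow> A i \<in> sets \<nu>"
    "disjoint_family_on A {..<n}"
    "\<And>\<omega>. \<omega> \<in> space P \<Longrightarrow>
      (\<integral>\<^sup>+l. of_nat (N \<omega> l) * g l \<partial>count_space UNIV) = (\<Sum>i<n. h i * num_points (N \<omega>) (A i))"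
    "\<And>u. (\<integral>\<^sup>+l. u (g l) \<partial>\<nu>) = (\<Sum>i<n. u (h i) * emeasure \<nu> (A i) :: ennreal)"
proof -
  have fin: "finite (g ` space \<nu>)" using g by (simp add: simple_function_def)
  obtain h n where bij: "bij_betw h {..<n::nat} (g ` space \<nu>)"
    using ex_bij_betw_nat_finite[OF fin] by (auto simp: atLeast0LessThan)
  define A where "A i = g -` {h i} \<inter> space \<nu>" for i
  have hS: "h i \<in> g ` space \<nu>" if "i < n" for i
    using bij that by (auto simp: bij_betw_def)
  have A: "A i \<in> sets \<nu>" if "i < n" for i
    unfolding A_def by (rule simple_functionD[OF g])
  have disj: "disjoint_family_on A {..<n}"
    using bij by (auto simp: disjoint_family_on_def A_def bij_betw_def inj_on_def)
  have decomp: "u (g l) = (\<Sum>i<n. u (h i) * indicator (A i) l)" if "l \<in> space \<nu>" for l and u :: "_ \<Rightarrow> ennreal"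
  proof -
    have "g l \<in> h ` {..<n}" using bij that by (simp add: bij_betw_def)
    then obtain j where j: "j < n" "h j = g l" by auto
    then have "(\<Sum>i<n. u (h i) * indicator (A i) l) = (\<Sum>i\<in>{j}. u (h i) * indicator (A i) l)"
      using bij that
      by (intro sum.mono_neutral_right) (auto simp: A_def bij_betw_def inj_on_def split: split_indicator)
    then show ?thesis using j that by (simp add: A_def)
  qed
  show ?thesis
  proof (rule that[OF hS A disj])
    fix \<omega> assume \<omega>: "\<omega> \<in> space P"
    have "(\<integral>\<^sup>+l. of_nat (N \<omega> l) * g l \<partial>count_space UNIV) =
        (\<integral>\<^sup>+l. (\<Sum>i<n. h i * (of_nat (N \<omega> l) * indicator (A i) l)) \<partial>count_space UNIV)"
    proof (rule nn_integral_cong)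
      fix l
      show "of_nat (N \<omega> l) * g l = (\<Sum>i<n. h i * (of_nat (N \<omega> l) * indicator (A i) l))"
      proof (cases "l \<in> space \<nu>")
        case True
        show ?thesis
          by (subst decomp[OF True, of "\<lambda>a. a"]) (simp only: sum_distrib_left mult_ac)
      next
        case False
        then show ?thesis using ppp \<omega> by (simp add: poisson_point_process_def)
      qed
    qed
    also have "\<dots> = (\<Sum>i<n. h i * num_points (N \<omega>) (A i))"
      by (simp add: nn_integral_sum nn_integral_cmult num_points_def
          nn_integral_count_space_indicator[of "A _"])
    finally show "(\<integral>\<^sup>+l. of_nat (N \<omega> l) * g l \<partial>count_space UNIV) =
      (\<Sum>i<n. h i * num_points (N \<omega>) (A i))" .
  next
    fix u :: "_ \<Rightarrow> ennreal"
    have "(\<integral>\<^sup>+l. u (g l) \<partial>\<nu>) = (\<integral>\<^sup>+l. (\<Sum>i<n. u (h i) * indicator (A i) l) \<partial>\<nu>)"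
      by (rule nn_integral_cong) (rule decomp)
    also have "\<dots> = (\<Sum>i<n. u (h i) * emeasure \<nu> (A i))"
      using A by (subst nn_integral_sum) (auto simp: nn_integral_cmult_indicator intro!: sum.cong)
    finally show "(\<integral>\<^sup>+l. u (g l) \<partial>\<nu>) = (\<Sum>i<n. u (h i) * emeasure \<nu> (A i))" .
  qed
qed

text \<open>
  Independence over the level sets factors the expectation, and \<open>exp_neg\<close> turns the product
  of the factors back into a sum.
\<close>
lemma poisson_point_process_laplace_simple:
  assumes ppp: "poisson_point_process P \<nu> N" and g: "simple_function \<nu> g"
    and gfin: "\<And>l. g l < top"
  shows "(\<lambda>\<omega>. \<integral>\<^sup>+l. of_nat (N \<omega> l) * g l \<partial>count_space UNIV) \<in> borel_measurable P"
    and "(\<integral>\<^sup>+\<omega>. ennreal (exp_neg (\<integral>\<^sup>+l. of_nat (N \<omega> l) * g l \<partial>count_space UNIV)) \<partial>P)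
      = ennreal (exp_neg (\<integral>\<^sup>+l. ennreal (1 - exp_neg (g l)) \<partial>\<nu>))"
proof -
  interpret prob_space P using ppp by (simp add: poisson_point_process_def)
  obtain n h A where h: "\<And>i. i < n \<Longrightarrow> h i \<in> g ` space \<nu>" and A: "\<And>i. i < (n::nat) \<Longrightarrow> A i \<in> sets \<nu>"
    and disj: "disjoint_family_on A {..<n}"
    and sumN: "\<And>\<omega>. \<omega> \<in> space P \<Longrightarrow>
      (\<integral>\<^sup>+l. of_nat (N \<omega> l) * g l \<partial>count_space UNIV) = (\<Sum>i<n. h i * num_points (N \<omega>) (A i))"
    and sumI: "\<And>u. (\<integral>\<^sup>+l. u (g l) \<partial>\<nu>) = (\<Sum>i<n. u (h i) * emeasure \<nu> (A i) :: ennreal)"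
    by (rule poisson_point_process_simple_sums[OF ppp g]) (rule that; simp)
  have meas [measurable]: "(\<lambda>\<omega>. num_points (N \<omega>) (A i)) \<in> borel_measurable P" if "i < n" for i
    using ppp A[OF that] by (simp add: poisson_point_process_def)
  show "(\<lambda>\<omega>. \<integral>\<^sup>+l. of_nat (N \<omega> l) * g l \<partial>count_space UNIV) \<in> borel_measurable P"
    by (simp add: sumN cong: measurable_cong)
  have hfin: "h i < top" if "i < n" for i using h[OF that] gfin by auto
  have indep: "indep_vars (\<lambda>_. borel) (\<lambda>i \<omega>. num_points (N \<omega>) (A i)) {..<n}"
    using ppp A disj by (simp add: poisson_point_process_def)
  have "(\<integral>\<^sup>+\<omega>. ennreal (exp_neg (\<integral>\<^sup>+l. of_nat (N \<omega> l) * g l \<partial>count_space UNIV)) \<partial>P)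
      = (\<integral>\<^sup>+\<omega>. (\<Prod>i<n. ennreal (exp_neg (h i * num_points (N \<omega>) (A i)))) \<partial>P)"
    by (rule nn_integral_cong) (simp add: sumN exp_neg_sum prod_ennreal)
  also have "\<dots> = (\<Prod>i<n. \<integral>\<^sup>+\<omega>. ennreal (exp_neg (h i * num_points (N \<omega>) (A i))) \<partial>P)"
    by (rule indep_vars_nn_integral[OF _ indep_vars_compose2[OF indep]]) auto
  also have "\<dots> = (\<Prod>i<n. ennreal (exp_neg (ennreal (1 - exp_neg (h i)) * emeasure \<nu> (A i))))"
    using h A by (intro prod.cong refl poisson_point_process_laplace_set[OF ppp]) (auto simp: hfin)
  also have "\<dots> = ennreal (exp_neg (\<Sum>i<n. ennreal (1 - exp_neg (h i)) * emeasure \<nu> (A i)))"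
    by (simp add: exp_neg_sum prod_ennreal)
  also have "(\<Sum>i<n. ennreal (1 - exp_neg (h i)) * emeasure \<nu> (A i)) = (\<integral>\<^sup>+l. ennreal (1 - exp_neg (g l)) \<partial>\<nu>)"
    by (rule sumI[symmetric])
  finally show "(\<integral>\<^sup>+\<omega>. ennreal (exp_neg (\<integral>\<^sup>+l. of_nat (N \<omega> l) * g l \<partial>count_space UNIV)) \<partial>P)
      = ennreal (exp_neg (\<integral>\<^sup>+l. ennreal (1 - exp_neg (g l)) \<partial>\<nu>))" .
qed

text \<open>
  Monotone approximation by simple functions. On the left, dominated convergence with bound \<open>1\<close>
  applies; on the right, \<open>1 - exp_neg\<close> is increasing, so monotone convergence applies. The sum over
  the points is measurable as the supremum of the approximating sums; were it not, the expectation
  would be \<open>0\<close> by convention.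
\<close>
lemma poisson_point_process_laplace:
  assumes ppp: "poisson_point_process P \<nu> N" and f: "f \<in> borel_measurable \<nu>"
  shows "prob_space.expectation P (\<lambda>\<omega>. exp_neg (\<integral>\<^sup>+l. of_nat (N \<omega> l) * f l \<partial>count_space UNIV))
    = exp_neg (\<integral>\<^sup>+l. ennreal (1 - exp_neg (f l)) \<partial>\<nu>)"
proof -
  interpret prob_space P using ppp by (simp add: poisson_point_process_def)
  obtain F where F: "\<And>i. simple_function \<nu> (F i)" "incseq F" "\<And>i l. F i l < top"
    and sup: "\<And>l. (SUP i. F i l) = f l"
    using borel_measurable_implies_simple_function_sequence'[OF f] by blast
  have incF: "incseq (\<lambda>i. F i l)" for l using F(2) by (auto simp: incseq_def le_fun_def)
  define S where "S g \<omega> = (\<integral>\<^sup>+l. of_nat (N \<omega> l) * g l \<partial>count_space UNIV)" for g and \<omega>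
  define J where "J g = (\<integral>\<^sup>+l. ennreal (1 - exp_neg (g l)) \<partial>\<nu>)" for g
  have S_inc: "incseq (\<lambda>i. S (F i) \<omega>)" for \<omega>
    unfolding S_def incseq_def
    by (intro allI impI nn_integral_mono mult_left_mono) (use incF in \<open>auto simp: incseq_def\<close>)
  have S_sup: "(SUP i. S (F i) \<omega>) = S f \<omega>" for \<omega>
  proof -
    have "S f \<omega> = (\<integral>\<^sup>+l. (SUP i. of_nat (N \<omega> l) * F i l) \<partial>count_space UNIV)"
      unfolding S_def by (simp add: sup[symmetric] SUP_mult_left_ennreal)
    also have "\<dots> = (SUP i. S (F i) \<omega>)"
      unfolding S_def
      by (rule nn_integral_monotone_convergence_SUP)
        (use incF in \<open>auto simp: incseq_def le_fun_def intro!: mult_left_mono\<close>)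
    finally show ?thesis ..
  qed
  have S_meas [measurable]: "S (F i) \<in> borel_measurable P" for i
    using poisson_point_process_laplace_simple(1)[OF ppp F(1,3)] by (simp add: S_def[abs_def])
  have [measurable]: "F i \<in> borel_measurable \<nu>" for i
    using F(1) by (rule borel_measurable_simple_function)
  have "(\<lambda>i. expectation (\<lambda>\<omega>. exp_neg (S (F i) \<omega>))) \<longlonglongrightarrow> expectation (\<lambda>\<omega>. exp_neg (S f \<omega>))"
  proof (rule integral_dominated_convergence[where w = "\<lambda>_. 1"])
    have "S f = (\<lambda>\<omega>. SUP i. S (F i) \<omega>)" by (simp add: S_sup)
    then have [measurable]: "S f \<in> borel_measurable P" by simp
    show "(\<lambda>\<omega>. exp_neg (S f \<omega>)) \<in> borel_measurable P" by measurable
    show "AE \<omega> in P. (\<lambda>i. exp_neg (S (F i) \<omega>)) \<longlonglongrightarrow> exp_neg (S f \<omega>)"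
      using LIMSEQ_exp_neg_SUP[OF S_inc] by (simp add: S_sup)
  qed auto
  moreover have "expectation (\<lambda>\<omega>. exp_neg (S (F i) \<omega>)) = exp_neg (J (F i))" for i
  proof -
    have "expectation (\<lambda>\<omega>. exp_neg (S (F i) \<omega>)) = enn2real (\<integral>\<^sup>+\<omega>. ennreal (exp_neg (S (F i) \<omega>)) \<partial>P)"
      by (rule integral_eq_nn_integral) auto
    then show ?thesis
      using poisson_point_process_laplace_simple(2)[OF ppp F(1,3), of i] by (simp add: S_def J_def)
  qed
  moreover have "(\<lambda>i. exp_neg (J (F i))) \<longlonglongrightarrow> exp_neg (J f)"
  proof -
    have inc: "incseq (\<lambda>i. ennreal (1 - exp_neg (F i l)))" for l
      using incF[of l] by (auto simp: incseq_def intro!: ennreal_leI exp_neg_antimono)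
    have "(\<lambda>i. ennreal (1 - exp_neg (F i l))) \<longlonglongrightarrow> ennreal (1 - exp_neg (f l))" for l
      using LIMSEQ_exp_neg_SUP[OF incF, of l] by (intro tendsto_ennrealI tendsto_diff tendsto_const) (simp add: sup)
    then have "(SUP i. ennreal (1 - exp_neg (F i l))) = ennreal (1 - exp_neg (f l))" for l
      using LIMSEQ_SUP[OF inc, of l] LIMSEQ_unique by blast
    then have "J f = (\<integral>\<^sup>+l. (SUP i. ennreal (1 - exp_neg (F i l))) \<partial>\<nu>)" by (simp add: J_def)
    also have "\<dots> = (SUP i. J (F i))" unfolding J_def
      by (rule nn_integral_monotone_convergence_SUP) (use inc in \<open>auto simp: incseq_def le_fun_def\<close>)
    finally have "J f = (SUP i. J (F i))" .
    moreover have "incseq (\<lambda>i. J (F i))"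
      unfolding J_def incseq_def
      by (intro allI impI nn_integral_mono) (use inc in \<open>auto simp: incseq_def\<close>)
    ultimately show ?thesis using LIMSEQ_exp_neg_SUP[of "\<lambda>i. J (F i)"] by simp
  qed
  ultimately have "expectation (\<lambda>\<omega>. exp_neg (S f \<omega>)) = exp_neg (J f)"
    by (simp add: LIMSEQ_unique)
  then show ?thesis by (simp add: S_def J_def)
qed

section \<open>Determinants as exponentials of traces\<close>

primrec matpow :: "real^'n^'n \<Rightarrow> nat \<Rightarrow> real^'n^'n" where
  "matpow A 0 = mat 1"
| "matpow A (Suc n) = A ** matpow A n"

lemma matpow_nonneg:
  assumes "\<And>x y. 0 \<le> A $ x $ y"
  shows "0 \<le> matpow A n $ x $ y"
proof (induction n arbitrary: x y)
  case (Suc n)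
  then show ?case using assms by (auto simp: matrix_matrix_mult_def intro!: sum_nonneg)
qed (simp add: mat_def)

lemma matrix_sub_ldistrib: "A ** (B - C) = A ** B - A ** (C :: real^'n^'n)"
  by (vector matrix_matrix_mult_def sum_subtractf right_diff_distrib)

lemma matrix_sub_rdistrib: "(A - B) ** C = A ** C - B ** (C :: real^'n^'n)"
  by (vector matrix_matrix_mult_def sum_subtractf left_diff_distrib)

lemma matrix_mul_matrix_inv:
  assumes "invertible A"
  shows "A ** matrix_inv A = mat 1"
  using someI_ex[OF assms[unfolded invertible_def]] by (simp add: matrix_inv_def)

lemma pos_def_mat_add_diag:
  fixes M :: "real^'n^'n"
  assumes M: "pos_def_mat M" and v: "\<And>x. 0 \<le> v $ x"
  shows "pos_def_mat (M + diag_mat v)"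
  unfolding pos_def_mat_def
proof (intro conjI allI impI)
  show "transpose (M + diag_mat v) = M + diag_mat v"
    using M by (auto simp: pos_def_mat_def transpose_def diag_mat_def vec_eq_iff)
  fix w :: "real^'n" assume "w \<noteq> 0"
  then have "0 < w \<bullet> (M *v w)" using M by (simp add: pos_def_mat_def)
  moreover have "w \<bullet> (diag_mat v *v w) = (\<Sum>x\<in>UNIV. v $ x * (w $ x)\<^sup>2)"
    by (simp add: inner_vec_def matrix_vector_mult_def diag_mat_def power2_eq_square
        if_distrib[of "\<lambda>a. a * _"] cong: if_cong) (simp add: mult_ac)
  ultimately show "0 < w \<bullet> ((M + diag_mat v) *v w)"
    using v by (simp add: matrix_vector_mult_add_rdistrib inner_add_right add_pos_nonneg sum_nonneg)
qed

text \<open>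
  In the Leibniz formula a permutation other than the identity moves at least two points, so
  its product vanishes to second order at the identity matrix and only the identity permutation
  contributes to the derivative.
\<close>
lemma has_field_derivative_det_at_one:
  fixes B :: "real^'n^'n"
  shows "((\<lambda>h. det (mat 1 + h *\<^sub>R B)) has_field_derivative trace B) (at 0)"
proof -
  let ?P = "{p. p permutes (UNIV :: 'n set)}"
  define D where "D p = (\<Sum>i\<in>UNIV. B $ i $ p i * (\<Prod>j\<in>UNIV - {i}. mat 1 $ j $ p j))" for p
  have D_id: "D id = trace B"
    by (simp add: D_def trace_def mat_def)
  have D_other: "D p = 0" if "p \<in> ?P" "p \<noteq> id" for p
  proof -
    obtain a where a: "p a \<noteq> a" using \<open>p \<noteq> id\<close> by (auto simp: fun_eq_iff)
    have pa: "p (p a) \<noteq> p a"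
      using a permutes_inj[of p UNIV] that(1) by (auto dest: injD)
    have "(\<Prod>j\<in>UNIV - {i}. mat 1 $ j $ p j :: real) = 0" for i
    proof -
      obtain j where j: "j \<in> UNIV - {i}" "j \<noteq> p j"
        using a pa by (metis DiffI UNIV_I singletonD)
      then have "mat 1 $ j $ p j = (0::real)" by (simp add: mat_def)
      with j(1) show ?thesis by (intro prod_zero) auto
    qed
    then show ?thesis by (simp only: D_def mult_zero_right sum.neutral_const)
  qed
  have prod: "((\<lambda>h. \<Prod>i\<in>UNIV. (mat 1 + h *\<^sub>R B) $ i $ p i) has_field_derivative D p) (at 0)" for p
  proof -
    have "((\<lambda>h. (mat 1 + h *\<^sub>R B) $ i $ p i) has_field_derivative B $ i $ p i) (at 0)" for i
      by (auto intro!: derivative_eq_intros)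
    then show ?thesis
      using has_field_derivative_prod[where A = UNIV and z = 0
          and f = "\<lambda>i h. (mat 1 + h *\<^sub>R B) $ i $ p i" and f' = "\<lambda>i. B $ i $ p i"]
      by (simp add: D_def)
  qed
  have "((\<lambda>h. det (mat 1 + h *\<^sub>R B)) has_field_derivative
      (\<Sum>p\<in>?P. of_int (sign p) * D p)) (at 0)"
    unfolding det_def by (intro DERIV_sum DERIV_cmult prod)
  also have "(\<Sum>p\<in>?P. of_int (sign p) * D p) = (\<Sum>p\<in>{id}. of_int (sign p) * D p)"
    by (rule sum.mono_neutral_right)
      (auto simp: D_other permutes_id finite_permutations)
  finally show ?thesis by (simp add: D_id sign_id)
qed

text \<open>
  Jacobi's formula along the line \<open>1 - s A\<close>. The factorization
  \<open>1 - (s + h) A = (1 - s A) (1 - h N A)\<close>, with \<open>N\<close> the resolvent, reduces it to the derivative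
  at the identity.
\<close>
lemma has_field_derivative_det_resolvent:
  fixes A N :: "real^'n^'n"
  assumes inv: "(mat 1 - s *\<^sub>R A) ** N = mat 1"
  shows "((\<lambda>s. det (mat 1 - s *\<^sub>R A)) has_field_derivative
    - det (mat 1 - s *\<^sub>R A) * trace (A ** N)) (at s)"
proof -
  have fac: "det (mat 1 - s *\<^sub>R A) * det (mat 1 + h *\<^sub>R (- (N ** A))) = det (mat 1 - (s + h) *\<^sub>R A)"
    for h
  proof -
    have "(mat 1 - s *\<^sub>R A) ** (h *\<^sub>R (N ** A)) = h *\<^sub>R A"
      by (metis inv matrix_mul_assoc matrix_mul_lid matrix_scalar_ac scalar_matrix_assoc scalar_mult_eq_scaleR)
    then have "(mat 1 - s *\<^sub>R A) ** (mat 1 + h *\<^sub>R (- (N ** A))) = mat 1 - (s + h) *\<^sub>R A"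
      by (simp add: matrix_sub_ldistrib matrix_sub_rdistrib algebra_simps)
    then show ?thesis by (metis det_mul)
  qed
  have "trace (- (N ** A)) = - trace (A ** N)"
    using trace_sub[of "0" "N ** A"] trace_mul_sym[of A N] by (simp add: trace_def)
  then have "((\<lambda>h. det (mat 1 - s *\<^sub>R A) * det (mat 1 + h *\<^sub>R (- (N ** A)))) has_field_derivative
      det (mat 1 - s *\<^sub>R A) * (- trace (A ** N))) (at 0)"
    using DERIV_cmult[OF has_field_derivative_det_at_one[of "- (N ** A)"], of "det (mat 1 - s *\<^sub>R A)"]
    by simp
  then show ?thesis
    using DERIV_shift[of "\<lambda>s. det (mat 1 - s *\<^sub>R A)" _ 0 s] unfolding fac
    by (simp add: add.commute)
qed

text \<open>
  With \<open>g s = \<Sum>\<^sub>n tr A\<^sup>n s\<^sup>n / n\<close> the product \<open>det (1 - s A) * exp (g s)\<close> has derivative \<open>0\<close>: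
  by Jacobi's formula the logarithmic derivative of the determinant is minus the trace of
  \<open>A (1 - s A)\<^sup>-\<^sup>1 = \<Sum>\<^sub>n A\<^sup>n\<^sup>+\<^sup>1 s\<^sup>n\<close>, which is \<open>- g' s\<close>. Comparing \<open>s = 0\<close> with \<open>s = 1\<close>
  gives the formula, with no logarithm and no sign of the determinant to be discussed.
\<close>
lemma det_one_minus_eq_exp_trace:
  fixes A :: "real^'n^'n"
  assumes r: "0 < r" "r < 1" and K: "\<And>n x y. \<bar>matpow A n $ x $ y\<bar> \<le> K * r ^ n"
  shows "summable (\<lambda>n. trace (matpow A (Suc n)) / real (Suc n))"
    and "det (mat 1 - A) = exp (- (\<Sum>n. trace (matpow A (Suc n)) / real (Suc n)))"
proof -
  \<comment> \<open>A radius beyond \<open>1\<close> at which the power series still converges, with ratio \<open>r * R = sqrt r\<close>.\<close>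
  define R where "R = 1 / sqrt r"
  have R: "1 < R" using r by (simp add: R_def real_less_lsqrt)
  have rR: "r * R = sqrt r" using r by (simp add: R_def real_div_sqrt)
  have R0: "0 \<le> R" using R by simp
  have geo: "summable (\<lambda>n. M * sqrt r ^ n)" for M
    using r by (intro summable_mult summable_geometric) (simp add: real_less_lsqrt)
  have bound: "\<bar>matpow A n $ x $ y * s ^ n\<bar> \<le> K * sqrt r ^ n" if "\<bar>s\<bar> \<le> R" for n x y s
  proof -
    have "\<bar>matpow A n $ x $ y * s ^ n\<bar> \<le> (K * r ^ n) * R ^ n"
      unfolding abs_mult power_abs
      by (intro mult_mono K power_mono that) (auto intro: order_trans[OF _ K])
    then show ?thesis by (simp add: rR[symmetric] power_mult_distrib mult_ac)
  qed
  have sm: "summable (\<lambda>n. matpow A n $ x $ y * s ^ n)" if "\<bar>s\<bar> \<le> R" for x y s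
    by (rule summable_comparison_test'[OF geo[of K], of 0]) (use bound[OF that] in auto)
  define c where "c n = trace (matpow A n) / real n" for n
  have c0: "c 0 = 0" by (simp add: c_def)
  have cbound: "norm (c n * R ^ n) \<le> (real CARD('n) * K) * sqrt r ^ n" for n
  proof -
    have "\<bar>trace (matpow A n) * R ^ n\<bar> \<le> (\<Sum>i\<in>(UNIV::'n set). K * sqrt r ^ n)"
      unfolding trace_def sum_distrib_right
      using R0 by (intro order_trans[OF sum_abs] sum_mono bound) auto
    moreover have "norm (c n * R ^ n) \<le> \<bar>trace (matpow A n) * R ^ n\<bar>"
    proof (cases n)
      case (Suc k)
      have "norm (c n * R ^ n) = \<bar>trace (matpow A n) * R ^ n\<bar> / real n"
        by (simp add: c_def abs_mult)
      also have "\<dots> \<le> \<bar>trace (matpow A n) * R ^ n\<bar> / 1"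
        using Suc by (intro divide_left_mono) auto
      finally show ?thesis by simp
    qed (simp add: c_def)
    ultimately show ?thesis by simp
  qed
  have csm: "summable (\<lambda>n. c n * R ^ n)"
    by (rule summable_comparison_test'[OF geo, of 0]) (use cbound in auto)
  define g where "g s = (\<Sum>n. c n * s ^ n)" for s
  define N where "N s = (\<chi> x y. \<Sum>n. matpow A n $ x $ y * s ^ n)" for s
  have dc: "diffs c n = trace (matpow A (Suc n))" for n
    by (simp add: diffs_def c_def)
  have AN: "(A ** N s) $ x $ y = (\<Sum>n. matpow A (Suc n) $ x $ y * s ^ n)"
    and sAN: "summable (\<lambda>n. matpow A (Suc n) $ x $ y * s ^ n)" if "\<bar>s\<bar> \<le> R" for s x y
  proof -
    have s: "summable (\<lambda>n. A $ x $ z * (matpow A n $ z $ y * s ^ n))" for z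
      by (intro summable_mult sm that)
    have "(A ** N s) $ x $ y = (\<Sum>z\<in>UNIV. \<Sum>n. A $ x $ z * (matpow A n $ z $ y * s ^ n))"
      by (simp add: matrix_matrix_mult_def N_def suminf_mult[OF sm[OF that]])
    also have "\<dots> = (\<Sum>n. \<Sum>z\<in>UNIV. A $ x $ z * (matpow A n $ z $ y * s ^ n))"
      by (rule suminf_sum[symmetric]) (rule s)
    finally show "(A ** N s) $ x $ y = (\<Sum>n. matpow A (Suc n) $ x $ y * s ^ n)"
      by (simp add: matrix_matrix_mult_def sum_distrib_right mult_ac sum_distrib_left)
    have "summable (\<lambda>n. \<Sum>z\<in>UNIV. A $ x $ z * (matpow A n $ z $ y * s ^ n))"
      by (rule summable_sum) (rule s)
    then show "summable (\<lambda>n. matpow A (Suc n) $ x $ y * s ^ n)"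
      by (simp add: matrix_matrix_mult_def sum_distrib_right mult_ac sum_distrib_left)
  qed
  have inv: "(mat 1 - s *\<^sub>R A) ** N s = mat 1" if "\<bar>s\<bar> \<le> R" for s
  proof -
    have "(N s - s *\<^sub>R (A ** N s)) $ x $ y = mat 1 $ x $ y" for x y
    proof -
      have "N s $ x $ y = mat 1 $ x $ y + (\<Sum>n. matpow A (Suc n) $ x $ y * s ^ Suc n)"
        using suminf_split_head[OF sm[OF that, of x y]] by (simp add: N_def)
      also have "(\<Sum>n. matpow A (Suc n) $ x $ y * s ^ Suc n) = s * (A ** N s) $ x $ y"
        unfolding AN[OF that] by (subst suminf_mult[symmetric, OF sAN[OF that]]) (simp add: mult_ac)
      finally show ?thesis by simp
    qed
    then have "N s - s *\<^sub>R (A ** N s) = mat 1" by (simp add: vec_eq_iff)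
    then show ?thesis
      by (simp add: matrix_sub_rdistrib scalar_matrix_assoc[symmetric] flip: scalar_mult_eq_scaleR)
  qed
  have trAN: "(\<Sum>n. diffs c n * s ^ n) = trace (A ** N s)" if "\<bar>s\<bar> \<le> R" for s
    unfolding trace_def AN[OF that] dc
    by (subst suminf_sum[symmetric]) (auto simp: sAN[OF that, simplified] sum_distrib_right trace_def)
  define H where "H s = det (mat 1 - s *\<^sub>R A) * exp (g s)" for s
  have dH: "(H has_field_derivative 0) (at s)" if "\<bar>s\<bar> < R" for s
  proof -
    have dg: "(g has_field_derivative trace (A ** N s)) (at s)"
      unfolding g_def trAN[OF less_imp_le[OF that], symmetric]
      by (rule termdiffs_strong[OF csm]) (use that R in auto)
    have dd: "((\<lambda>s. det (mat 1 - s *\<^sub>R A)) has_field_derivative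
        - det (mat 1 - s *\<^sub>R A) * trace (A ** N s)) (at s)"
      by (rule has_field_derivative_det_resolvent[OF inv]) (use that in simp)
    show ?thesis unfolding H_def
      by (rule derivative_eq_intros dg dd refl)+ (simp add: algebra_simps)
  qed
  have "H 1 = H 0"
  proof (rule DERIV_isconst_end[where f = H and a = 0 and b = 1])
    show "continuous_on {0..1} H"
      using R by (intro continuous_at_imp_continuous_on ballI DERIV_isCont[OF dH]) auto
  qed (use R in \<open>auto intro!: dH\<close>)
  moreover have "g 0 = 0" by (simp add: g_def c0)
  ultimately have H1: "det (mat 1 - A) * exp (g 1) = 1"
    by (simp add: H_def det_I)
  have c1: "summable c"
    using summable_comparison_test'[of "\<lambda>n. norm (c n * R ^ n)" 0 c]
      summable_comparison_test'[OF geo[of "real CARD('n) * K"], of 0 "\<lambda>n. norm (c n * R ^ n)"] cbound R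
    by (auto simp: abs_mult power_abs mult_le_cancel_left1 one_le_power)
  show "summable (\<lambda>n. trace (matpow A (Suc n)) / real (Suc n))"
    using c1 by (subst (asm) summable_Suc_iff[symmetric]) (simp only: c_def)
  have "g 1 = (\<Sum>n. trace (matpow A (Suc n)) / real (Suc n))"
    unfolding g_def c_def[of "Suc _", symmetric] using suminf_split_head[OF c1] by (simp add: c0)
  then show "det (mat 1 - A) = exp (- (\<Sum>n. trace (matpow A (Suc n)) / real (Suc n)))"
    using H1 by (simp add: exp_minus field_simps del: matpow.simps)
qed

text \<open>
  Test the inequality with the negative part \<open>w\<close> of \<open>u\<close>. Where \<open>w\<close> is positive, the positive part
  \<open>u + w\<close> vanishes and \<open>C \<ge> 0\<close> forces \<open>((D - C) (u + w))\<^sub>x \<le> 0\<close>, where \<open>D = diag_mat d\<close>. Hence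
  \<open>w \<bullet> (D - C) w \<le> 0\<close>, and positive definiteness gives \<open>w = 0\<close>.
\<close>
lemma Z_matrix_monotone:
  fixes C :: "real^'n^'n" and d u :: "real^'n"
  assumes C: "\<And>x y. 0 \<le> C $ x $ y" and pd: "pos_def_mat (diag_mat d - C)"
    and u: "\<And>x. 0 \<le> ((diag_mat d - C) *v u) $ x"
  shows "0 \<le> u $ x"
proof -
  let ?M = "diag_mat d - C"
  have Mv: "(?M *v v) $ x = d $ x * v $ x - (\<Sum>y\<in>UNIV. C $ x $ y * v $ y)" for v x
    by (simp add: matrix_vector_mult_def diag_mat_def left_diff_distrib sum_subtractf
        if_distrib[of "\<lambda>a. a * _"] cong: if_cong)
  define w where "w = (\<chi> x. max 0 (- u $ x))"
  have "w $ x * (?M *v w) $ x \<le> - (w $ x * (?M *v u) $ x)" for x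
  proof -
    have "w $ x * (?M *v (u + w)) $ x \<le> 0"
    proof (cases "u $ x \<le> 0")
      case True
      then have "(u + w) $ x = 0" by (simp add: w_def)
      then have "(?M *v (u + w)) $ x = - (\<Sum>y\<in>UNIV. C $ x $ y * (u + w) $ y)"
        by (simp only: Mv)
      also have "\<dots> \<le> 0"
        by (auto simp: w_def intro!: sum_nonneg mult_nonneg_nonneg C)
      finally show ?thesis by (intro mult_nonneg_nonpos) (simp_all add: w_def)
    next
      case False
      then have "w $ x = 0" by (simp add: w_def)
      then show ?thesis by simp
    qed
    then show ?thesis by (simp add: matrix_vector_right_distrib algebra_simps)
  qed
  moreover have "- (w $ x * (?M *v u) $ x) \<le> 0" for x
    using u[of x] by (auto simp: w_def intro!: mult_nonneg_nonneg)
  ultimately have "w \<bullet> (?M *v w) \<le> 0"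
    unfolding inner_vec_def inner_real_def by (intro sum_nonpos) (rule order_trans)
  then have "w = 0" using pd by (auto simp: pos_def_mat_def not_le[symmetric])
  then have "max 0 (- u $ x) = 0" by (metis w_def vec_lambda_beta zero_index)
  then show ?thesis by linarith
qed

text \<open>
  Perron-Frobenius theory is replaced by an explicit weight. The solution \<open>u\<close> of
  \<open>(diag_mat d - C) u = d\<close> is nonnegative by \<open>Z_matrix_monotone\<close> and satisfies \<open>A u = u - 1\<close>;
  thus \<open>u \<ge> 1\<close> and \<open>A u \<le> r u\<close> for some \<open>r < 1\<close>. Iterating gives \<open>A\<^sup>n u \<le> r\<^sup>n u\<close>, which bounds
  each entry of \<open>A\<^sup>n\<close>.
\<close>
lemma matpow_geometric_decay:
  fixes C :: "real^'n^'n" and d :: "real^'n"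
  assumes C: "\<And>x y. 0 \<le> C $ x $ y" and d: "\<And>x. 0 < d $ x"
    and pd: "pos_def_mat (diag_mat d - C)"
  obtains K r where "0 < r" "r < 1"
    "\<And>n x y. \<bar>matpow (\<chi> x y. C $ x $ y / d $ x) n $ x $ y\<bar> \<le> K * r ^ n"
proof -
  let ?M = "diag_mat d - C"
  define A where "A = (\<chi> x y. C $ x $ y / d $ x)"
  have A: "0 \<le> A $ x $ y" for x y using C d by (simp add: A_def less_imp_le)
  have Mv: "(?M *v v) $ x = d $ x * v $ x - (\<Sum>y\<in>UNIV. C $ x $ y * v $ y)" for v x
    by (simp add: matrix_vector_mult_def diag_mat_def left_diff_distrib sum_subtractf
        if_distrib[of "\<lambda>a. a * _"] cong: if_cong)
  have "v = 0" if "?M *v v = 0" for v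
    using pd that by (force simp: pos_def_mat_def)
  then have "inj ((*v) ?M)"
    by (simp add: linear_injective_0)
  then have "surj ((*v) ?M)"
    by (intro linear_injective_imp_surjective) simp_all
  then obtain u where u: "?M *v u = d" by (metis surjD)
  have u0: "0 \<le> u $ x" for x
    by (rule Z_matrix_monotone[OF C pd]) (simp add: u d less_imp_le)
  have Au: "(\<Sum>y\<in>UNIV. A $ x $ y * u $ y) = u $ x - 1" for x
  proof -
    have "d $ x * (\<Sum>y\<in>UNIV. A $ x $ y * u $ y) = (\<Sum>y\<in>UNIV. C $ x $ y * u $ y)"
      using d[of x] by (simp add: A_def sum_distrib_left)
    also have "\<dots> = d $ x * (u $ x - 1)"
      using Mv[of u x] u by (simp add: algebra_simps)
    finally show ?thesis using d[of x] by simp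
  qed
  have u1: "1 \<le> u $ x" for x
    using Au[of x] sum_nonneg[of UNIV "\<lambda>y. A $ x $ y * u $ y"] A u0 by simp
  define U where "U = (\<Sum>x\<in>UNIV. u $ x)"
  have uU: "u $ x \<le> U" for x
    unfolding U_def by (rule member_le_sum) (auto intro: u0)
  \<comment> \<open>\<open>u - 1 \<le> r * u\<close> amounts to \<open>u \<le> U + 1\<close>; the summand \<open>1\<close> keeps \<open>r\<close> positive and below \<open>1\<close>.\<close>
  define r where "r = U / (U + 1)"
  have U1: "1 \<le> U" using uU u1 order_trans by blast
  have r: "0 < r" "r < 1" using U1 by (auto simp: r_def)
  have contr: "(\<Sum>y\<in>UNIV. A $ x $ y * u $ y) \<le> r * u $ x" for x
    unfolding Au r_def using U1 uU[of x] by (simp add: field_simps)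
  have iter: "(\<Sum>y\<in>UNIV. matpow A n $ x $ y * u $ y) \<le> r ^ n * u $ x" for n x
  proof (induction n arbitrary: x)
    case 0
    then show ?case
      by (simp add: mat_def if_distrib[of "\<lambda>a. a * _"] cong: if_cong)
  next
    case (Suc n)
    have "(\<Sum>y\<in>UNIV. matpow A (Suc n) $ x $ y * u $ y)
        = (\<Sum>z\<in>UNIV. A $ x $ z * (\<Sum>y\<in>UNIV. matpow A n $ z $ y * u $ y))"
      by (simp add: matrix_matrix_mult_def sum_distrib_left sum_distrib_right mult_ac)
        (rule sum.swap)
    also have "\<dots> \<le> (\<Sum>z\<in>UNIV. A $ x $ z * (r ^ n * u $ z))"
      by (intro sum_mono mult_left_mono Suc A)
    also have "\<dots> = r ^ n * (\<Sum>z\<in>UNIV. A $ x $ z * u $ z)"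
      by (simp add: sum_distrib_left mult_ac)
    also have "\<dots> \<le> r ^ n * (r * u $ x)"
      using r by (intro mult_left_mono contr) simp
    finally show ?case by (simp add: mult_ac)
  qed
  have "\<bar>matpow A n $ x $ y\<bar> \<le> U * r ^ n" for n x y
  proof -
    have nn: "0 \<le> matpow A n $ x $ y" for x y by (rule matpow_nonneg) (rule A)
    have "\<bar>matpow A n $ x $ y\<bar> \<le> matpow A n $ x $ y * u $ y"
      using mult_left_mono[OF u1 nn, of x y y] nn[of x y] by simp
    also have "\<dots> \<le> (\<Sum>y\<in>UNIV. matpow A n $ x $ y * u $ y)"
      by (rule member_le_sum[of y UNIV]) (auto intro!: mult_nonneg_nonneg nn u0)
    also have "\<dots> \<le> r ^ n * u $ x" by (rule iter)
    also have "\<dots> \<le> r ^ n * U" using r by (intro mult_left_mono uU) simp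
    finally show ?thesis by (simp add: mult_ac)
  qed
  with r show ?thesis unfolding A_def by (rule that)
qed

lemma det_diag_minus_eq_exp_trace:
  fixes C :: "real^'n^'n" and d :: "real^'n"
  assumes C: "\<And>x y. 0 \<le> C $ x $ y" and d: "\<And>x. 0 < d $ x"
    and pd: "pos_def_mat (diag_mat d - C)"
  defines "A \<equiv> \<chi> x y. C $ x $ y / d $ x"
  shows "summable (\<lambda>n. trace (matpow A (Suc n)) / real (Suc n))"
    and "det (diag_mat d - C) =
      (\<Prod>x\<in>UNIV. d $ x) * exp (- (\<Sum>n. trace (matpow A (Suc n)) / real (Suc n)))"
proof -
  obtain K r where Kr: "0 < r" "r < 1" "\<And>n x y. \<bar>matpow A n $ x $ y\<bar> \<le> K * r ^ n"
    unfolding A_def by (rule matpow_geometric_decay[OF C d pd]) auto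
  show "summable (\<lambda>n. trace (matpow A (Suc n)) / real (Suc n))"
    by (rule det_one_minus_eq_exp_trace(1)[OF Kr])
  have "diag_mat d ** (mat 1 - A) = diag_mat d - C"
  proof -
    have "(diag_mat d ** B) $ x $ y = d $ x * B $ x $ y" for B :: "real^'n^'n" and x y
      by (simp add: matrix_matrix_mult_def diag_mat_def if_distrib[of "\<lambda>a. a * _"] cong: if_cong)
    then show ?thesis
      using d by (simp add: vec_eq_iff)
        (simp add: diag_mat_def A_def mat_def right_diff_distrib less_imp_neq[THEN not_sym])
  qed
  then have "det (diag_mat d - C) = det (diag_mat d) * det (mat 1 - A)"
    by (metis det_mul)
  also have "det (diag_mat d) = (\<Prod>x\<in>UNIV. d $ x)"
    by (subst det_diagonal) (simp_all add: diag_mat_def)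
  finally show "det (diag_mat d - C) =
      (\<Prod>x\<in>UNIV. d $ x) * exp (- (\<Sum>n. trace (matpow A (Suc n)) / real (Suc n)))"
    by (simp only: det_one_minus_eq_exp_trace(2)[OF Kr])
qed

section \<open>Traces of powers as sums over cyclic words\<close>

text \<open>
  The weight of the path from \<open>x\<close> to \<open>y\<close> whose intermediate points are listed. Closing up a path
  at its starting point gives a cyclic product, so that traces of powers become sums over skeletons.
\<close>
primrec walk :: "real^'n^'n \<Rightarrow> 'n \<Rightarrow> 'n list \<Rightarrow> 'n \<Rightarrow> real" where
  "walk A x [] y = A $ x $ y"
| "walk A x (z # zs) y = A $ x $ z * walk A z zs y"

lemma sum_lists_Suc:
  fixes f :: "'a::finite list \<Rightarrow> 'b::comm_monoid_add"
  shows "(\<Sum>xs | length xs = Suc n. f xs) = (\<Sum>x\<in>UNIV. \<Sum>xs | length xs = n. f (x # xs))"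
proof -
  have "(\<Sum>x\<in>UNIV. \<Sum>xs | length xs = n. f (x # xs)) =
      (\<Sum>(x, xs)\<in>UNIV \<times> {xs. length xs = n}. f (x # xs))"
    by (rule sum.cartesian_product)
  also have "\<dots> = (\<Sum>xs | length xs = Suc n. f xs)"
    by (rule sum.reindex_bij_witness[where i = "\<lambda>xs. (hd xs, tl xs)" and j = "\<lambda>(x, xs). x # xs"])
      (auto simp: length_Suc_conv)
  finally show ?thesis by simp
qed

lemma sum_walk: "(\<Sum>xs | length xs = n. walk A x xs y) = matpow A (Suc n) $ x $ y"
proof (induction n arbitrary: x)
  case 0
  then show ?case by simp
next
  case (Suc n)
  then show ?case
    by (simp add: sum_lists_Suc sum_distrib_left[symmetric])
      (simp add: matrix_matrix_mult_def)
qed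

lemma walk_eq_prod:
  "walk A x xs y = (\<Prod>i<Suc (length xs). A $ ((x # xs @ [y]) ! i) $ ((x # xs @ [y]) ! Suc i))"
proof (induction xs arbitrary: x)
  case (Cons z zs)
  then show ?case by (simp add: prod.lessThan_Suc_shift del: prod.lessThan_Suc)
qed simp

abbreviation cyclic_prod :: "real^'n^'n \<Rightarrow> 'n list \<Rightarrow> real" where
  "cyclic_prod A xi \<equiv> \<Prod>i<length xi. A $ (xi ! i) $ (xi ! ((i + 1) mod length xi))"

lemma cyclic_prod_eq_walk: "cyclic_prod A (x # xs) = walk A x xs x"
proof -
  have "(x # xs) ! i = (x # xs @ [x]) ! i \<and>
      (x # xs) ! ((i + 1) mod length (x # xs)) = (x # xs @ [x]) ! Suc i"
    if "i < length (x # xs)" for i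
    using that by (cases "i = length xs") (auto simp: nth_append nth_Cons')
  then show ?thesis
    unfolding walk_eq_prod by (intro prod.cong) (simp_all only: length_Cons lessThan_iff)
qed

lemma sum_cyclic_prod_eq_trace:
  fixes A :: "real^'n^'n"
  shows "(\<Sum>xi | length xi = Suc n. cyclic_prod A xi)
    = trace (matpow A (Suc n))"
  by (simp only: sum_lists_Suc cyclic_prod_eq_walk trace_def sum_walk)

section \<open>Integration against the loop measure\<close>

lemma measurable_loop_density:
  assumes "xi \<noteq> []"
  shows "loop_density C \<kappa> xi \<in> borel_measurable (times xi)"
proof (cases "length xi = 1")
  case True
  then show ?thesis by (simp add: loop_density_def[abs_def])
next
  case False
  then show ?thesis by (simp add: loop_density_def[abs_def] Let_def)
qed

lemma slice_based_loops_sets: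
  "xi \<noteq> [] \<Longrightarrow> slice xi based_loops \<in> sets (times xi)"
  by (simp add: slice_based_loops sets_PiM_I_finite)

lemma slice_mono: "A \<subseteq> B \<Longrightarrow> slice xi A \<subseteq> slice xi B"
  by (auto simp: slice_def)

lemma vimage_skeleton_eq_slice:
  "{t \<in> space (times xi). (xi, map t [0..<length xi]) \<in> A} = slice xi A"
  by (auto simp: slice_def space_PiM PiE_def)

text \<open>
  Only holding times with positive entries form a based loop, which is why the function has to be
  cut off by the indicator of the slice.
\<close>
lemma measurable_on_skeleton:
  fixes f :: "'n::finite based_loop \<Rightarrow> ennreal"
  assumes xi: "xi \<noteq> []" and f: "f \<in> borel_measurable (based_loop_measure C \<kappa>)"
  shows "(\<lambda>t. f (xi, map t [0..<length xi]) * indicator (slice xi based_loops) t)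
    \<in> borel_measurable (times xi)"
proof -
  let ?R = "restrict_space (times xi) (slice xi based_loops)"
  have "(\<lambda>t. (xi, map t [0..<length xi])) \<in> ?R \<rightarrow>\<^sub>M based_loop_measure C \<kappa>"
  proof (rule measurableI)
    fix t assume "t \<in> space ?R"
    then show "(xi, map t [0..<length xi]) \<in> space (based_loop_measure C \<kappa>)"
      by (simp add: space_restrict_space slice_def)
  next
    fix A assume "A \<in> sets (based_loop_measure C \<kappa>)"
    then have A: "A \<in> based_loop_sets" by simp
    then have sA: "slice xi A \<in> sets (times xi)" and sub: "slice xi A \<subseteq> slice xi based_loops"
      using xi by (auto simp: based_loop_sets_def intro!: slice_mono)
    have "(\<lambda>t. (xi, map t [0..<length xi])) -` A \<inter> space ?R = slice xi A"
      using sub vimage_skeleton_eq_slice[of xi A] by (auto simp: space_restrict_space)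
    then show "(\<lambda>t. (xi, map t [0..<length xi])) -` A \<inter> space ?R \<in> sets ?R"
      using sA sub by (auto simp: sets_restrict_space)
  qed
  from measurable_compose[OF this f] show ?thesis
    by (subst (asm) borel_measurable_restrict_space_iff_ennreal)
      (use slice_based_loops_sets[OF xi] in auto)
qed

text \<open>
  The defining formula of the based loop measure on sets extends to functions by linearity and
  monotone convergence.
\<close>
lemma nn_integral_based_loop_measure:
  fixes f :: "'n::finite based_loop \<Rightarrow> ennreal"
  assumes f: "f \<in> borel_measurable (based_loop_measure C \<kappa>)"
  shows "(\<integral>\<^sup>+b. f b \<partial>based_loop_measure C \<kappa>) =
    (\<integral>\<^sup>+xi. (\<integral>\<^sup>+t. ennreal (loop_density C \<kappa> xi t) *
        (f (xi, map t [0..<length xi]) * indicator (slice xi based_loops) t) \<partial>times xi)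
      \<partial>count_space {xi. xi \<noteq> []})"
    (is "_ = (\<integral>\<^sup>+xi. ?T xi f \<partial>?S)")
proof -
  let ?M = "based_loop_measure C \<kappa>"
  have meas [measurable]: "(\<lambda>t. ennreal (loop_density C \<kappa> xi t)) \<in> borel_measurable (times xi)"
    if "xi \<noteq> []" for xi
    using measurable_loop_density[OF that] by measurable
  have skel: "(\<lambda>t. ennreal (loop_density C \<kappa> xi t) *
      (u (xi, map t [0..<length xi]) * indicator (slice xi based_loops) t)) \<in> borel_measurable (times xi)"
    if "xi \<noteq> []" "u \<in> borel_measurable ?M" for xi u
    by (rule borel_measurable_times_ennreal[OF meas[OF that(1)] measurable_on_skeleton[OF that]])
  show ?thesis using f
  proof induction
    case (cong f g)
    have "?T xi f = ?T xi g" for xi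
      using cong(3) by (intro nn_integral_cong) (auto simp: slice_def split: split_indicator)
    moreover have "integral\<^sup>N ?M f = integral\<^sup>N ?M g"
      by (rule nn_integral_cong) (use cong in simp)
    ultimately show ?case using cong by simp
  next
    case (set A)
    then have A: "A \<in> based_loop_sets" by simp
    have "emeasure (density (times xi) (\<lambda>t. ennreal (loop_density C \<kappa> xi t))) (slice xi A)
        = ?T xi (indicator A)" if "xi \<noteq> []" for xi
    proof -
      have sA: "slice xi A \<in> sets (times xi)" using A that by (simp add: based_loop_sets_def)
      have "slice xi A \<subseteq> slice xi based_loops"
        using A by (intro slice_mono) (simp add: based_loop_sets_def)
      then have ind: "indicator A (xi, map t [0..<length xi]) * indicator (slice xi based_loops) t
          = (indicator (slice xi A) t :: ennreal)" if "t \<in> space (times xi)" for t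
        using that by (auto simp: slice_def space_PiM PiE_def split: split_indicator)
      show ?thesis using that sA
        by (simp add: emeasure_density ind cong: nn_integral_cong_simp)
    qed
    then show ?case
      using A by (simp add: emeasure_based_loop_measure cong: nn_integral_cong_simp)
  next
    case (mult u c)
    have "?T xi (\<lambda>x. c * u x) = c * ?T xi u" if "xi \<noteq> []" for xi
      using nn_integral_cmult[OF skel[OF that mult(2)], of c] by (simp add: mult_ac)
    then show ?case using mult by (simp add: nn_integral_cmult cong: nn_integral_cong_simp)
  next
    case (add u v)
    have "?T xi (\<lambda>x. v x + u x) = ?T xi v + ?T xi u" if "xi \<noteq> []" for xi
      using nn_integral_add[OF skel[OF that add(3)] skel[OF that add(1)]]
      by (simp add: distrib_left distrib_right)
    then show ?case using add by (simp add: nn_integral_add cong: nn_integral_cong_simp)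
  next
    case (seq U)
    have inc: "incseq (\<lambda>i. ?T xi (U i))" for xi
      using seq(3) unfolding incseq_def le_fun_def
      by (intro allI impI nn_integral_mono mult_left_mono mult_right_mono) auto
    have "?T xi (SUP i. U i) = (SUP i. ?T xi (U i))" if "xi \<noteq> []" for xi
    proof -
      have "?T xi (SUP i. U i) = (\<integral>\<^sup>+t. (SUP i. ennreal (loop_density C \<kappa> xi t) *
          (U i (xi, map t [0..<length xi]) * indicator (slice xi based_loops) t)) \<partial>times xi)"
        by (simp add: SUP_mult_left_ennreal SUP_mult_right_ennreal SUP_apply image_comp)
      also have "\<dots> = (SUP i. ?T xi (U i))"
        using seq(1,3) that
        by (intro nn_integral_monotone_convergence_SUP skel)
          (auto simp: incseq_def le_fun_def intro!: mult_left_mono mult_right_mono)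
      finally show ?thesis .
    qed
    then have "(\<integral>\<^sup>+xi. ?T xi (SUP i. U i) \<partial>?S) = (SUP i. \<integral>\<^sup>+xi. ?T xi (U i) \<partial>?S)"
      using inc
      by (subst nn_integral_monotone_convergence_SUP[symmetric])
        (auto simp: incseq_def le_fun_def cong: nn_integral_cong_simp)
    moreover have "(\<integral>\<^sup>+b. (SUP i. U i) b \<partial>?M) = (SUP i. \<integral>\<^sup>+b. U i b \<partial>?M)"
      using seq(1,3) by (simp add: nn_integral_monotone_convergence_SUP[symmetric] SUP_apply image_comp)
    ultimately show ?case using seq by simp
  qed
qed

lemma borel_measurable_based_loopI:
  fixes g :: "'n::finite based_loop \<Rightarrow> real"
  assumes "\<And>xi. xi \<noteq> [] \<Longrightarrow> (\<lambda>t. g (xi, map t [0..<length xi])) \<in> borel_measurable (times xi)"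
  shows "g \<in> borel_measurable (based_loop_measure C \<kappa>)"
proof (rule measurableI)
  fix B :: "real set" assume B: "B \<in> sets borel"
  have "slice xi (g -` B \<inter> based_loops) \<in> sets (times xi)" if xi: "xi \<noteq> []" for xi
  proof -
    have "slice xi (g -` B \<inter> based_loops) =
        ((\<lambda>t. g (xi, map t [0..<length xi])) -` B \<inter> space (times xi)) \<inter> slice xi based_loops"
      by (auto simp: slice_def space_PiM PiE_def)
    then show ?thesis
      using measurable_sets[OF assms[OF xi] B] slice_based_loops_sets[OF xi] by simp
  qed
  then show "g -` B \<inter> space (based_loop_measure C \<kappa>) \<in> sets (based_loop_measure C \<kappa>)"
    by (auto simp: based_loop_sets_def)
qed simp

lemma borel_measurable_loopI:
  fixes f :: "'n::finite loop \<Rightarrow> real"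
  assumes f: "(\<lambda>b. f (loop_of b)) \<in> borel_measurable (based_loop_measure C \<kappa>)"
  shows "f \<in> borel_measurable (loop_measure C \<kappa>)"
proof (rule measurableI)
  fix B :: "real set" assume B: "B \<in> sets borel"
  have "loop_of \<in> based_loops \<rightarrow> loops"
    by (auto simp: loops_def loop_of_def quotient_def)
  then have "loop_of -` (f -` B \<inter> loops) \<inter> based_loops = (\<lambda>b. f (loop_of b)) -` B \<inter> based_loops"
    by auto
  also have "\<dots> \<in> based_loop_sets"
    using measurable_sets[OF f B] by simp
  finally show "f -` B \<inter> space (loop_measure C \<kappa>) \<in> sets (loop_measure C \<kappa>)"
    by (auto simp: loop_sets_def)
qed simp

lemma nn_integral_loop_measure:
  assumes "f \<in> borel_measurable (loop_measure C \<kappa>)"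
  shows "(\<integral>\<^sup>+l. f l \<partial>loop_measure C \<kappa>) = (\<integral>\<^sup>+b. f (loop_of b) \<partial>based_loop_measure C \<kappa>)"
  using assms unfolding loop_measure_def by (intro nn_integral_distr measurable_loop_of)

section \<open>The occupation field of a loop\<close>

definition loop_energy :: "real^'n \<Rightarrow> 'n loop \<Rightarrow> real" where
  "loop_energy v l = (\<Sum>x\<in>UNIV. occ l x * v $ x)"

lemma loop_energy_loop_of:
  assumes "(xi, map t [0..<length xi]) \<in> based_loops"
  shows "loop_energy v (loop_of (xi, map t [0..<length xi])) = (\<Sum>i<length xi. v $ (xi ! i) * t i)"
proof -
  have "loop_energy v (loop_of (xi, map t [0..<length xi]))
      = (\<Sum>x\<in>UNIV. \<Sum>i<length xi. (if xi ! i = x then t i else 0) * v $ x)"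
    by (simp add: loop_energy_def occ_loop_of[OF assms] based_occ_def sum_distrib_right
        cong: if_cong)
  also have "\<dots> = (\<Sum>i<length xi. \<Sum>x\<in>UNIV. (if xi ! i = x then t i else 0) * v $ x)"
    by (rule sum.swap)
  also have "\<dots> = (\<Sum>i<length xi. v $ (xi ! i) * t i)"
    by (intro sum.cong refl) (simp add: if_distrib[of "\<lambda>a. a * _"] cong: if_cong)
  finally show ?thesis .
qed

lemma measurable_occ: "(\<lambda>l. occ l x) \<in> borel_measurable (loop_measure C \<kappa>)"
proof (rule borel_measurable_loopI)
  have "(\<lambda>b. based_occ b x) \<in> borel_measurable (based_loop_measure C \<kappa>)"
  proof (rule borel_measurable_based_loopI)
    fix xi :: "'a list"
    have [measurable]: "(\<lambda>t. if xi ! i = x then t i else 0) \<in> borel_measurable (times xi)"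
      if "i < length xi" for i
      using that by (cases "xi ! i = x") simp_all
    show "(\<lambda>t. based_occ (xi, map t [0..<length xi]) x) \<in> borel_measurable (times xi)"
      by (simp add: based_occ_def cong: if_cong)
  qed
  then show "(\<lambda>b. occ (loop_of b) x) \<in> borel_measurable (based_loop_measure C \<kappa>)"
    by (rule measurable_cong[THEN iffD1, rotated]) (simp add: occ_loop_of)
qed

lemma measurable_loop_energy: "loop_energy v \<in> borel_measurable (loop_measure C \<kappa>)"
  unfolding loop_energy_def[abs_def]
  by (intro borel_measurable_sum borel_measurable_times measurable_occ) simp

lemma occ_nonneg: "l \<in> loops \<Longrightarrow> 0 \<le> occ l x"
proof -
  assume "l \<in> loops"
  then obtain b where b: "b \<in> based_loops" "l = loop_of b"
    by (auto simp: loops_def loop_of_def quotient_def)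
  then show ?thesis
    by (auto simp: occ_loop_of based_occ_def based_loops_def less_imp_le intro!: sum_nonneg)
qed

section \<open>Integrals over a single skeleton\<close>

lemma nn_integral_exp_Ioi:
  assumes c: "0 < (c::real)"
  shows "(\<integral>\<^sup>+t. ennreal (exp (- c * t)) * indicator {0<..} t \<partial>lborel) = ennreal (1 / c)"
proof -
  have "(\<integral>\<^sup>+t. ennreal (exp (- c * t)) * indicator {0<..} t \<partial>lborel)
      = (\<integral>\<^sup>+t. ennreal (exp (- c * t)) * indicator {0..} t \<partial>lborel)"
    by (rule nn_integral_cong_AE, use AE_lborel_singleton[of 0] in eventually_elim)
      (auto split: split_indicator)
  also have "\<dots> = ennreal (0 - (- exp (- c * 0) / c))"
  proof (rule nn_integral_FTC_atLeast)
    show "((\<lambda>t. - exp (- c * t) / c) \<longlongrightarrow> 0) at_top"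
    proof -
      have "filterlim (\<lambda>t. - (c * t)) at_bot at_top"
        using filterlim_tendsto_pos_mult_at_top[OF tendsto_const c filterlim_ident]
        by (simp add: filterlim_uminus_at_top)
      then have "((\<lambda>t. exp (- (c * t))) \<longlongrightarrow> 0) at_top"
        by (rule filterlim_compose[OF exp_at_bot])
      then have "((\<lambda>t. - exp (- (c * t)) / c) \<longlongrightarrow> - 0 / c) at_top"
        using c by (intro tendsto_intros) auto
      then show ?thesis by simp
    qed
  qed (use c in \<open>auto intro!: derivative_eq_intros\<close>)
  finally show ?thesis by simp
qed

text \<open>
  Write \<open>(1 - exp (- b t)) / t\<close> as the integral of \<open>exp (- u t)\<close> over \<open>u\<close> in \<open>[0, b]\<close> and
  exchange the integrals.
\<close>
lemma nn_integral_frullani: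
  assumes a: "0 < (a::real)" and b: "0 \<le> b"
  shows "(\<integral>\<^sup>+t. ennreal (exp (- a * t) / t * (1 - exp (- b * t))) * indicator {0<..} t \<partial>lborel)
    = ennreal (ln ((a + b) / a))"
proof -
  have "(\<integral>\<^sup>+t. ennreal (exp (- a * t) / t * (1 - exp (- b * t))) * indicator {0<..} t \<partial>lborel)
      = (\<integral>\<^sup>+t. (\<integral>\<^sup>+u. ennreal (exp (- (a + u) * t)) * indicator {0..b} u * indicator {0<..} t \<partial>lborel) \<partial>lborel)"
  proof (rule nn_integral_cong)
    fix t :: real
    show "ennreal (exp (- a * t) / t * (1 - exp (- b * t))) * indicator {0<..} t =
      (\<integral>\<^sup>+u. ennreal (exp (- (a + u) * t)) * indicator {0..b} u * indicator {0<..} t \<partial>lborel)"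
    proof (cases "0 < t")
      case True
      have "(\<integral>\<^sup>+u. ennreal (exp (- (a + u) * t)) * indicator {0..b} u \<partial>lborel)
          = ennreal (- exp (- (a + b) * t) / t - - exp (- (a + 0) * t) / t)"
        using True b by (intro nn_integral_FTC_Icc) (auto intro!: derivative_eq_intros)
      also have "- exp (- (a + b) * t) / t - - exp (- (a + 0) * t) / t
          = exp (- a * t) / t * (1 - exp (- b * t))"
        using True by (simp add: field_simps exp_add[symmetric])
      finally show ?thesis using True by simp
    qed simp
  qed
  also have "\<dots> = (\<integral>\<^sup>+u. (\<integral>\<^sup>+t. ennreal (exp (- (a + u) * t)) * indicator {0..b} u * indicator {0<..} t \<partial>lborel) \<partial>lborel)"
    by (rule lborel_pair.Fubini') measurable
  also have "\<dots> = (\<integral>\<^sup>+u. ennreal (1 / (a + u)) * indicator {0..b} u \<partial>lborel)"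
  proof (rule nn_integral_cong)
    fix u :: real
    show "(\<integral>\<^sup>+t. ennreal (exp (- (a + u) * t)) * indicator {0..b} u * indicator {0<..} t \<partial>lborel)
        = ennreal (1 / (a + u)) * indicator {0..b} u"
      using a nn_integral_exp_Ioi[of "a + u"] by (auto split: split_indicator)
  qed
  also have "\<dots> = ennreal (ln (a + b) - ln (a + 0))"
    using a b by (intro nn_integral_FTC_Icc) (auto intro!: derivative_eq_intros)
  finally show ?thesis using a b by (simp add: ln_div)
qed

lemma nn_integral_exp_skeleton:
  fixes d :: "real^'n"
  assumes xi: "xi \<noteq> []" and d: "\<And>x. 0 < d $ x" and W: "0 \<le> W"
  shows "(\<integral>\<^sup>+t. ennreal (W * (\<Prod>i<length xi. exp (- d $ (xi ! i) * t i))) *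
      indicator (slice xi based_loops) t \<partial>times xi)
    = ennreal (W * (\<Prod>i<length xi. 1 / d $ (xi ! i)))"
proof -
  interpret product_sigma_finite "\<lambda>_::nat. lborel :: real measure" by standard
  let ?e = "\<lambda>i s. ennreal (exp (- d $ (xi ! i) * s)) * indicator {0<..} s"
  have "(\<integral>\<^sup>+t. ennreal (W * (\<Prod>i<length xi. exp (- d $ (xi ! i) * t i))) *
      indicator (slice xi based_loops) t \<partial>times xi)
    = (\<integral>\<^sup>+t. ennreal W * (\<Prod>i<length xi. ?e i (t i)) \<partial>times xi)"
  proof (rule nn_integral_cong)
    fix t assume "t \<in> space (times xi)"
    then have "indicator (slice xi based_loops) t = (\<Prod>i<length xi. indicator {0<..} (t i) :: ennreal)"
      by (auto simp: slice_based_loops[OF xi] space_PiM PiE_def Pi_def indicator_def prod_zero_iff)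
    then show "ennreal (W * (\<Prod>i<length xi. exp (- d $ (xi ! i) * t i))) *
      indicator (slice xi based_loops) t = ennreal W * (\<Prod>i<length xi. ?e i (t i))"
      by (simp add: prod.distrib ennreal_mult W prod_nonneg prod_ennreal[symmetric] mult_ac)
  qed
  also have "\<dots> = ennreal W * (\<integral>\<^sup>+t. (\<Prod>i<length xi. ?e i (t i)) \<partial>times xi)"
    by (rule nn_integral_cmult) measurable
  also have "(\<integral>\<^sup>+t. (\<Prod>i<length xi. ?e i (t i)) \<partial>times xi) = (\<Prod>i<length xi. \<integral>\<^sup>+s. ?e i s \<partial>lborel)"
    by (rule product_nn_integral_prod) auto
  also have "ennreal W * (\<Prod>i<length xi. \<integral>\<^sup>+s. ?e i s \<partial>lborel) =
      ennreal W * (\<Prod>i<length xi. ennreal (1 / d $ (xi ! i)))"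
    using nn_integral_exp_Ioi[OF d] by simp
  also have "\<dots> = ennreal (W * (\<Prod>i<length xi. 1 / d $ (xi ! i)))"
    using W d by (simp add: ennreal_mult prod_ennreal prod_nonneg less_imp_le)
  finally show ?thesis .
qed

text \<open>
  The factor \<open>1 - exp (- \<Sum>\<^sub>i v t\<^sub>i)\<close> splits the integral into two product integrals, with rates
  \<open>\<lambda>\<close> and \<open>\<lambda> + v\<close>. Since subtraction on the extended nonnegative reals is truncated, the second is
  first added to both sides and then cancelled; this also yields that the difference is nonnegative.
\<close>
lemma nn_integral_skeleton_ge2:
  fixes C :: "real^'n^'n" and \<kappa> v :: "real^'n"
  assumes C: "\<And>x y. 0 \<le> C $ x $ y" and l: "\<And>x. 0 < lam C \<kappa> $ x" and v: "\<And>x. 0 \<le> v $ x"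
    and len: "2 \<le> length xi"
  defines "A \<equiv> \<chi> x y. C $ x $ y / lam C \<kappa> $ x"
    and "B \<equiv> \<chi> x y. C $ x $ y / (lam C \<kappa> + v) $ x"
  shows "(\<integral>\<^sup>+t. ennreal (loop_density C \<kappa> xi t) *
      (ennreal (1 - exp (- (\<Sum>i<length xi. v $ (xi ! i) * t i))) * indicator (slice xi based_loops) t) \<partial>times xi)
    = ennreal ((cyclic_prod A xi - cyclic_prod B xi) / real (length xi))" (is "?T = _")
    and "0 \<le> (cyclic_prod A xi - cyclic_prod B xi) / real (length xi)"
proof -
  let ?p = "length xi"
  have xi: "xi \<noteq> []" using len by auto
  define W where "W = 1 / real ?p * cyclic_prod C xi"
  have W: "0 \<le> W" by (simp add: W_def prod_nonneg C)
  have m: "0 < (lam C \<kappa> + v) $ x" for x using l[of x] v[of x] by simp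
  define E where "E d t = (\<Prod>i<?p. exp (- d $ (xi ! i) * t i))" for d :: "real^'n" and t
  have dens: "loop_density C \<kappa> xi t = W * E (lam C \<kappa>) t" for t
    using len by (simp add: loop_density_def Let_def W_def E_def prod.distrib)
  have shift: "E (lam C \<kappa>) t * exp (- (\<Sum>i<?p. v $ (xi ! i) * t i)) = E (lam C \<kappa> + v) t" for t
    by (simp add: E_def exp_sum[symmetric] exp_add[symmetric] sum_negf[symmetric] sum.distrib[symmetric]
        algebra_simps)
  have E_meas [measurable]: "E d \<in> borel_measurable (times xi)" for d
    unfolding E_def[abs_def] by simp
  have E_nn: "0 \<le> E d t" for d t by (simp add: E_def prod_nonneg)
  let ?I = "indicator (slice xi based_loops) :: _ \<Rightarrow> ennreal"
  have [measurable]: "slice xi based_loops \<in> sets (times xi)"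
    by (rule slice_based_loops_sets[OF xi])
  have [measurable]: "(\<lambda>t. \<Sum>i<?p. v $ (xi ! i) * t i) \<in> borel_measurable (times xi)" by simp
  have int: "(\<integral>\<^sup>+t. ennreal (W * E d t) * ?I t \<partial>times xi) = ennreal (W * (\<Prod>i<?p. 1 / d $ (xi ! i)))"
    if "\<And>x. 0 < d $ x" for d
    unfolding E_def by (rule nn_integral_exp_skeleton[OF xi that W])
  have wts: "W * (\<Prod>i<?p. 1 / d $ (xi ! i)) = cyclic_prod (\<chi> x y. C $ x $ y / d $ x) xi / real ?p" for d
    by (simp add: W_def prod_dividef)
  define a where "a = cyclic_prod A xi / real ?p"
  define b where "b = cyclic_prod B xi / real ?p"
  have a0: "0 \<le> a" unfolding a_def A_def using C l by (auto intro!: divide_nonneg_nonneg prod_nonneg simp: less_imp_le)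
  have b0: "0 \<le> b" unfolding b_def B_def using C m
    by (auto intro!: divide_nonneg_nonneg prod_nonneg simp: less_imp_le simp del: vector_add_component)
  have "?T + ennreal b = (\<integral>\<^sup>+t. ennreal (loop_density C \<kappa> xi t) *
      (ennreal (1 - exp (- (\<Sum>i<?p. v $ (xi ! i) * t i))) * ?I t) + ennreal (W * E (lam C \<kappa> + v) t) * ?I t \<partial>times xi)"
    unfolding b_def B_def wts[symmetric] int[OF m, symmetric] dens
    by (rule nn_integral_add[symmetric]) measurable
  also have "\<dots> = (\<integral>\<^sup>+t. ennreal (W * E (lam C \<kappa>) t) * ?I t \<partial>times xi)"
  proof (rule nn_integral_cong)
    fix t assume "t \<in> space (times xi)"
    show "ennreal (loop_density C \<kappa> xi t) * (ennreal (1 - exp (- (\<Sum>i<?p. v $ (xi ! i) * t i))) * ?I t)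
        + ennreal (W * E (lam C \<kappa> + v) t) * ?I t = ennreal (W * E (lam C \<kappa>) t) * ?I t"
    proof (cases "t \<in> slice xi based_loops")
      case True
      then have "0 \<le> (\<Sum>i<?p. v $ (xi ! i) * t i)"
        using v by (auto simp: slice_based_loops[OF xi] PiE_def Pi_def less_imp_le intro!: sum_nonneg mult_nonneg_nonneg)
      then have q: "exp (- (\<Sum>i<?p. v $ (xi ! i) * t i)) \<le> 1" by simp
      have "ennreal (W * E (lam C \<kappa>) t) * ennreal (1 - q) + ennreal (W * (E (lam C \<kappa>) t * q))
          = ennreal (W * E (lam C \<kappa>) t)" if "0 \<le> q" "q \<le> 1" for q
      proof -
        have "ennreal (W * E (lam C \<kappa>) t) * ennreal (1 - q) + ennreal (W * (E (lam C \<kappa>) t * q))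
            = ennreal (W * E (lam C \<kappa>) t * (1 - q) + W * (E (lam C \<kappa>) t * q))"
          using that W E_nn[of "lam C \<kappa>" t] by (simp add: ennreal_mult ennreal_plus)
        then show ?thesis by (simp add: algebra_simps)
      qed
      from this[OF _ q] show ?thesis
        unfolding dens shift[symmetric] by (simp add: True)
    qed simp
  qed
  also have "\<dots> = ennreal a"
    unfolding a_def A_def wts[symmetric] by (rule int[OF l])
  finally have eq: "?T + ennreal b = ennreal a" .
  have "ennreal b \<le> ennreal a" unfolding eq[symmetric] by simp
  then have ab: "b \<le> a" using a0 by simp
  have "?T = ennreal a - ennreal b" unfolding eq[symmetric] by simp
  also have "\<dots> = ennreal (a - b)" using b0 by (simp add: ennreal_minus)
  finally show "?T = ennreal ((cyclic_prod A xi - cyclic_prod B xi) / real ?p)"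
    by (simp add: a_def b_def diff_divide_distrib)
  show "0 \<le> (cyclic_prod A xi - cyclic_prod B xi) / real ?p"
    using ab by (simp add: a_def b_def diff_divide_distrib)
qed

text \<open>
  The density \<open>exp (- \<lambda> t) / t\<close> of a one-point loop is not integrable at \<open>0\<close>, so here the two terms
  of \<open>1 - exp (- v t)\<close> cannot be integrated separately.
\<close>
lemma nn_integral_skeleton_trivial:
  fixes C :: "real^'n^'n" and \<kappa> v :: "real^'n"
  assumes l: "0 < lam C \<kappa> $ x" and v: "0 \<le> v $ x"
  shows "(\<integral>\<^sup>+t. ennreal (loop_density C \<kappa> [x] t) *
      (ennreal (1 - exp (- (\<Sum>i<length [x]. v $ ([x] ! i) * t i))) * indicator (slice [x] based_loops) t) \<partial>times [x])
    = ennreal (ln ((lam C \<kappa> + v) $ x / lam C \<kappa> $ x))"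
proof -
  interpret product_sigma_finite "\<lambda>_::nat. lborel :: real measure" by standard
  let ?f = "\<lambda>s. ennreal (exp (- lam C \<kappa> $ x * s) / s * (1 - exp (- v $ x * s))) * indicator {0<..} s"
  have ts: "times [x] = Pi\<^sub>M {0::nat} (\<lambda>_. lborel)" by (simp add: lessThan_Suc)
  have "(\<integral>\<^sup>+t. ennreal (loop_density C \<kappa> [x] t) *
      (ennreal (1 - exp (- (\<Sum>i<length [x]. v $ ([x] ! i) * t i))) * indicator (slice [x] based_loops) t) \<partial>times [x])
    = (\<integral>\<^sup>+t. ?f (t 0) \<partial>Pi\<^sub>M {0::nat} (\<lambda>_. lborel))"
    unfolding ts
  proof (rule nn_integral_cong)
    fix t assume "t \<in> space (Pi\<^sub>M {0::nat} (\<lambda>_. lborel :: real measure))"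
    then have "t \<in> slice [x] based_loops \<longleftrightarrow> 0 < t 0"
      by (auto simp: slice_based_loops space_PiM PiE_def Pi_def lessThan_Suc)
    then show "ennreal (loop_density C \<kappa> [x] t) * (ennreal (1 - exp (- (\<Sum>i<length [x]. v $ ([x] ! i) * t i))) *
        indicator (slice [x] based_loops) t) = ?f (t 0)"
      using v by (auto simp: loop_density_def ennreal_mult'[symmetric] split: split_indicator)
  qed
  also have "\<dots> = (\<integral>\<^sup>+s. ?f s \<partial>lborel)"
    by (rule product_nn_integral_singleton) measurable
  also have "\<dots> = ennreal (ln ((lam C \<kappa> $ x + v $ x) / lam C \<kappa> $ x))"
    by (rule nn_integral_frullani[OF l v])
  finally show ?thesis by simp
qed

section \<open>The Laplace transform of the occupation field\<close>

lemma nn_integral_count_space_nonempty_lists: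
  fixes g :: "'a::finite list \<Rightarrow> ennreal"
  shows "(\<integral>\<^sup>+xi. g xi \<partial>count_space {xi. xi \<noteq> []}) = (\<Sum>n. \<Sum>xi | length xi = Suc n. g xi)"
proof -
  have fin: "finite {xi :: 'a list. length xi = n}" for n
    using finite_lists_length_eq[of "UNIV :: 'a set" n] by simp
  have "(\<integral>\<^sup>+xi. g xi \<partial>count_space {xi. xi \<noteq> []}) =
      (\<integral>\<^sup>+xi. (\<Sum>n. if length xi = Suc n then g xi else 0) \<partial>count_space {xi. xi \<noteq> []})"
  proof (rule nn_integral_cong)
    fix xi :: "'a list" assume "xi \<in> space (count_space {xi. xi \<noteq> []})"
    then obtain m where m: "length xi = Suc m" by (cases xi) auto
    have "(\<Sum>n. if length xi = Suc n then g xi else 0) = (\<Sum>n\<in>{m}. if length xi = Suc n then g xi else 0)"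
      by (rule suminf_finite) (auto simp: m)
    then show "g xi = (\<Sum>n. if length xi = Suc n then g xi else 0)" by (simp add: m)
  qed
  also have "\<dots> = (\<Sum>n. \<integral>\<^sup>+xi. (if length xi = Suc n then g xi else 0) \<partial>count_space {xi. xi \<noteq> []})"
    by (rule nn_integral_suminf) simp
  also have "\<dots> = (\<Sum>n. \<Sum>xi | length xi = Suc n. g xi)"
    by (intro suminf_cong, subst nn_integral_count_space'[OF fin]) auto
  finally show ?thesis .
qed

text \<open>
  Sorting the skeletons by length, level \<open>n + 1\<close> contributes \<open>(tr A\<^sup>n\<^sup>+\<^sup>1 - tr B\<^sup>n\<^sup>+\<^sup>1) / (n + 1)\<close>
  for \<open>n \<ge> 1\<close>, and level \<open>1\<close> contributes the logarithms of the one-point loops. The trace term of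
  level \<open>1\<close> is \<open>0\<close> because \<open>C\<close> has zero diagonal, so both trace series can be summed over all
  \<open>n\<close>.
\<close>
lemma loop_measure_laplace_exponent:
  fixes C :: "real^'n^'n" and \<kappa> v :: "real^'n"
  assumes C: "\<And>x y. 0 \<le> C $ x $ y" and C0: "\<And>x. C $ x $ x = 0"
    and l: "\<And>x. 0 < lam C \<kappa> $ x" and pd: "pos_def_mat (diag_mat (lam C \<kappa>) - C)"
    and v: "\<And>x. 0 \<le> v $ x"
  obtains E where "0 \<le> E"
    "(\<integral>\<^sup>+l. ennreal (1 - exp_neg (ennreal (loop_energy v l))) \<partial>loop_measure C \<kappa>) = ennreal E"
    "0 < det (diag_mat (lam C \<kappa>) - C)" "0 < det (diag_mat (lam C \<kappa>) + diag_mat v - C)"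
    "exp (- E) = det (diag_mat (lam C \<kappa>) - C) / det (diag_mat (lam C \<kappa>) + diag_mat v - C)"
proof -
  define m where "m = lam C \<kappa> + v"
  have m: "0 < m $ x" for x using l[of x] v[of x] by (simp add: m_def)
  have dm: "diag_mat (lam C \<kappa>) + diag_mat v = diag_mat m"
    by (simp add: diag_mat_def m_def vec_eq_iff)
  have pdm: "pos_def_mat (diag_mat m - C)"
    using pos_def_mat_add_diag[OF pd v] by (simp add: dm[symmetric] algebra_simps)
  define A where "A = (\<chi> x y. C $ x $ y / lam C \<kappa> $ x)"
  define B where "B = (\<chi> x y. C $ x $ y / m $ x)"
  note dA = det_diag_minus_eq_exp_trace[OF C l pd, folded A_def]
  note dB = det_diag_minus_eq_exp_trace[OF C m pdm, folded B_def]
  define SA where "SA = (\<Sum>n. trace (matpow A (Suc n)) / real (Suc n))"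
  define SB where "SB = (\<Sum>n. trace (matpow B (Suc n)) / real (Suc n))"
  define E0 where "E0 = (\<Sum>x\<in>UNIV. ln (m $ x / lam C \<kappa> $ x))"
  define e where "e n = (if n = 0 then E0 else 0) +
    (trace (matpow A (Suc n)) / real (Suc n) - trace (matpow B (Suc n)) / real (Suc n))" for n
  have ln0: "0 \<le> ln (m $ x / lam C \<kappa> $ x)" for x
    using l[of x] v[of x] by (intro ln_ge_zero) (simp add: m_def)
  define T where "T xi = (\<integral>\<^sup>+t. ennreal (loop_density C \<kappa> xi t) *
      (ennreal (1 - exp (- (\<Sum>i<length xi. v $ (xi ! i) * t i))) * indicator (slice xi based_loops) t) \<partial>times xi)" for xi
  have level: "(\<Sum>xi | length xi = Suc n. T xi) = ennreal (e n)" "0 \<le> e n" for n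
  proof (induction n)
    case 0
    have "e 0 = E0"
      by (simp add: e_def trace_def A_def B_def C0)
    moreover have "(\<Sum>xi | length xi = Suc 0. T xi) = (\<Sum>x\<in>UNIV. T [x])"
      by (simp add: sum_lists_Suc)
    moreover have "T [x] = ennreal (ln (m $ x / lam C \<kappa> $ x))" for x
      unfolding T_def m_def by (rule nn_integral_skeleton_trivial[OF l v])
    ultimately show "(\<Sum>xi | length xi = Suc 0. T xi) = ennreal (e 0)" "0 \<le> e 0"
      by (simp_all add: E0_def ln0 sum_ennreal sum_nonneg)
  next
    case (Suc k)
    let ?n = "Suc (Suc k)"
    let ?d = "\<lambda>xi. (cyclic_prod A xi - cyclic_prod B xi) / real (length xi)"
    have T: "T xi = ennreal (?d xi)" "0 \<le> ?d xi" if "length xi = ?n" for xi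
      using nn_integral_skeleton_ge2[OF C l v, of xi] that
      unfolding T_def A_def B_def m_def by auto
    have "(\<Sum>xi | length xi = ?n. ?d xi) =
        (\<Sum>xi | length xi = ?n. cyclic_prod A xi - cyclic_prod B xi) / real ?n"
      unfolding sum_divide_distrib by (rule sum.cong) auto
    also have "\<dots> = e (Suc k)"
      by (simp only: sum_subtractf sum_cyclic_prod_eq_trace e_def diff_divide_distrib) simp
    finally have d: "(\<Sum>xi | length xi = ?n. ?d xi) = e (Suc k)" .
    have "(\<Sum>xi | length xi = ?n. T xi) = (\<Sum>xi | length xi = ?n. ennreal (?d xi))"
      by (rule sum.cong) (auto simp: T)
    also have "\<dots> = ennreal (\<Sum>xi | length xi = ?n. ?d xi)"
      by (rule sum_ennreal) (use T(2) in auto)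
    finally show "(\<Sum>xi | length xi = ?n. T xi) = ennreal (e (Suc k))" by (simp only: d)
    show "0 \<le> e (Suc k)" unfolding d[symmetric] by (rule sum_nonneg) (use T(2) in auto)
  qed
  define E where "E = E0 + (SA - SB)"
  have esum: "e sums E"
    unfolding e_def[abs_def] E_def SA_def SB_def
    by (intro sums_add sums_diff summable_sums dA(1) dB(1)) (rule sums_single[of 0 "\<lambda>_. E0"])
  have E0: "0 \<le> E" using esum level(2) by (metis sums_le sums_zero)
  have meas: "(\<lambda>l. ennreal (1 - exp_neg (ennreal (loop_energy v l)))) \<in> borel_measurable (loop_measure C \<kappa>)"
    using measurable_loop_energy[of v C \<kappa>] by measurable
  have "(\<integral>\<^sup>+l. ennreal (1 - exp_neg (ennreal (loop_energy v l))) \<partial>loop_measure C \<kappa>)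
      = (\<integral>\<^sup>+xi. T xi \<partial>count_space {xi. xi \<noteq> []})"
  proof -
    let ?u = "\<lambda>b. ennreal (1 - exp_neg (ennreal (loop_energy v (loop_of b))))"
    have mb: "?u \<in> borel_measurable (based_loop_measure C \<kappa>)"
    proof (rule measurable_compose[OF measurable_loop_of])
      show "(\<lambda>l. ennreal (1 - exp_neg (ennreal (loop_energy v l)))) \<in> borel_measurable (sigma loops loop_sets)"
        using meas unfolding loop_measure_def by simp
    qed
    have "?u (xi, map t [0..<length xi]) * indicator (slice xi based_loops) t
      = ennreal (1 - exp (- (\<Sum>i<length xi. v $ (xi ! i) * t i))) * indicator (slice xi based_loops) t" for xi t
    proof (cases "t \<in> slice xi based_loops")
      case True
      then have b: "(xi, map t [0..<length xi]) \<in> based_loops" by (simp add: slice_def)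
      then have "0 \<le> (\<Sum>i<length xi. v $ (xi ! i) * t i)"
        using v by (auto simp: based_loops_def less_imp_le intro!: sum_nonneg mult_nonneg_nonneg)
      then show ?thesis by (simp add: loop_energy_loop_of[OF b] exp_neg_ennreal)
    qed simp
    then show ?thesis
      unfolding nn_integral_loop_measure[OF meas] nn_integral_based_loop_measure[OF mb] T_def
      by (simp only:)
  qed
  also have "\<dots> = (\<Sum>n. ennreal (e n))"
    by (simp only: nn_integral_count_space_nonempty_lists level(1))
  also have "\<dots> = ennreal E"
    by (rule suminf_ennreal_eq[OF level(2) esum])
  finally have int: "(\<integral>\<^sup>+l. ennreal (1 - exp_neg (ennreal (loop_energy v l))) \<partial>loop_measure C \<kappa>) = ennreal E" .
  have pl: "0 < (\<Prod>x\<in>UNIV. lam C \<kappa> $ x)" and pm: "0 < (\<Prod>x\<in>UNIV. m $ x)"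
    by (auto intro!: prod_pos l m)
  have "exp (- E0) = (\<Prod>x\<in>UNIV. lam C \<kappa> $ x) / (\<Prod>x\<in>UNIV. m $ x)"
    unfolding E0_def sum_negf[symmetric] exp_sum[OF finite] prod_dividef[symmetric]
    using l m by (intro prod.cong refl) (simp add: exp_minus)
  then have "exp (- E) = det (diag_mat (lam C \<kappa>) - C) / det (diag_mat m - C)"
    unfolding dA(2) dB(2) E_def SA_def[symmetric] SB_def[symmetric]
    using exp_add[of "- E0" "SB - SA"] l[THEN less_imp_neq, THEN not_sym] m[THEN less_imp_neq, THEN not_sym]
    by (simp add: exp_diff exp_minus field_simps)
  moreover have "0 < det (diag_mat (lam C \<kappa>) - C)" "0 < det (diag_mat m - C)"
    unfolding dA(2) dB(2) using pl pm by simp_all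
  ultimately show ?thesis
    using that[OF E0 int] by (simp add: dm)
qed

theorem proposition3:
  fixes C :: "real^'n^'n" and \<kappa> chi :: "real^'n" and \<alpha> :: real
    and P :: "'w measure" and L :: "'w \<Rightarrow> 'n loop \<Rightarrow> nat"
  assumes C_sym: "transpose C = C"
    and C_nonneg: "\<And>x y. 0 \<le> C $ x $ y"
    and C_diag: "\<And>x. C $ x $ x = 0"
    and C_irred: "irreducible_mat C"
    and kappa_nonneg: "\<And>x. 0 \<le> \<kappa> $ x"
    and lam_pos: "\<And>x. 0 < lam C \<kappa> $ x"
    and mass_gap: "pos_def_mat (diag_mat (lam C \<kappa>) - C)"
    and alpha_pos: "0 < \<alpha>"
    and L_poisson: "poisson_point_process P (scale_measure (ennreal \<alpha>) (loop_measure C \<kappa>)) L"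
    and chi_nonneg: "\<And>x. 0 \<le> chi $ x"
  shows "prob_space.expectation P (\<lambda>\<omega>. exp_neg (pairing (occ_field (L \<omega>)) chi))
           = det (mat 1 + green C \<kappa> ** diag_mat chi) powr (- \<alpha>)
       \<and> det (mat 1 + green C \<kappa> ** diag_mat chi) powr (- \<alpha>)
           = det (mat 1 - green_pert C \<kappa> chi ** diag_mat chi) powr \<alpha>
       \<and> det (mat 1 - green_pert C \<kappa> chi ** diag_mat chi) powr \<alpha>
           = det (green_pert C \<kappa> chi ** matrix_inv (green C \<kappa>)) powr \<alpha>"
proof -
  let ?\<nu> = "scale_measure (ennreal \<alpha>) (loop_measure C \<kappa>)"
  define M where "M = diag_mat (lam C \<kappa>) - C"
  define M' where "M' = diag_mat (lam C \<kappa>) + diag_mat chi - C"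
  have M': "M' = M + diag_mat chi" by (simp add: M_def M'_def)
  obtain E where E: "0 \<le> E"
    "(\<integral>\<^sup>+l. ennreal (1 - exp_neg (ennreal (loop_energy chi l))) \<partial>loop_measure C \<kappa>) = ennreal E"
    and D: "0 < det M" "0 < det M'" and expE: "exp (- E) = det M / det M'"
    unfolding M_def M'_def
    by (rule loop_measure_laplace_exponent[OF C_nonneg C_diag lam_pos mass_gap chi_nonneg])
  have inv: "invertible M" "invertible M'" using D by (auto simp: invertible_det_nz)
  have MG: "M ** green C \<kappa> = mat 1" and MG': "M' ** green_pert C \<kappa> chi = mat 1"
    unfolding green_def green_pert_def M_def[symmetric] M'_def[symmetric]
    by (intro matrix_mul_matrix_inv inv)+
  have "M ** (mat 1 + green C \<kappa> ** diag_mat chi) = M'"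
    by (simp add: matrix_add_ldistrib matrix_mul_assoc MG M')
  then have "det M * det (mat 1 + green C \<kappa> ** diag_mat chi) = det M'"
    by (metis det_mul)
  then have d1: "det (mat 1 + green C \<kappa> ** diag_mat chi) = det M' / det M"
    using D by (simp add: field_simps)
  have "M' ** (mat 1 - green_pert C \<kappa> chi ** diag_mat chi) = M"
    by (simp add: matrix_sub_ldistrib matrix_mul_assoc MG') (simp add: M')
  then have "det M' * det (mat 1 - green_pert C \<kappa> chi ** diag_mat chi) = det M"
    by (metis det_mul)
  then have d2: "det (mat 1 - green_pert C \<kappa> chi ** diag_mat chi) = det M / det M'"
    using D by (simp add: field_simps)
  have "det (green C \<kappa>) * det (matrix_inv (green C \<kappa>)) = 1" "det M * det (green C \<kappa>) = 1"
    "det M' * det (green_pert C \<kappa> chi) = 1"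
    using MG MG' by (metis det_mul det_I matrix_mul_matrix_inv invertible_left_inverse)+
  then have d3: "det (green_pert C \<kappa> chi ** matrix_inv (green C \<kappa>)) = det M / det M'"
    using D by (simp add: det_mul field_simps) (metis mult.commute mult.left_commute mult.right_neutral)
  have pair: "pairing (occ_field (L \<omega>)) chi =
      (\<integral>\<^sup>+l. of_nat (L \<omega> l) * ennreal (loop_energy chi l) \<partial>count_space UNIV)"
    if \<omega>: "\<omega> \<in> space P" for \<omega>
  proof -
    have "pairing (occ_field (L \<omega>)) chi =
        (\<integral>\<^sup>+l. (\<Sum>x\<in>UNIV. of_nat (L \<omega> l) * ennreal (occ l x) * ennreal (chi $ x)) \<partial>count_space UNIV)"
      by (simp add: pairing_def occ_field_def nn_integral_sum nn_integral_multc)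
    also have "\<dots> = (\<integral>\<^sup>+l. of_nat (L \<omega> l) * ennreal (loop_energy chi l) \<partial>count_space UNIV)"
    proof (rule nn_integral_cong)
      fix l :: "'n loop"
      show "(\<Sum>x\<in>UNIV. of_nat (L \<omega> l) * ennreal (occ l x) * ennreal (chi $ x)) =
        of_nat (L \<omega> l) * ennreal (loop_energy chi l)"
      proof (cases "l \<in> loops")
        case True
        have "ennreal (loop_energy chi l) = (\<Sum>x\<in>UNIV. ennreal (occ l x) * ennreal (chi $ x))"
          unfolding loop_energy_def using occ_nonneg[OF True] chi_nonneg
          by (subst sum_ennreal[symmetric]) (auto simp: ennreal_mult)
        then show ?thesis by (simp add: sum_distrib_left mult_ac)
      next
        case False
        then have "L \<omega> l = 0"
          using L_poisson \<omega> by (simp add: poisson_point_process_def space_scale_measure)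
        then show ?thesis by simp
      qed
    qed
    finally show ?thesis .
  qed
  have meas: "(\<lambda>l. ennreal (loop_energy chi l)) \<in> borel_measurable (loop_measure C \<kappa>)"
    using measurable_loop_energy[of chi C \<kappa>] by measurable
  then have meas': "(\<lambda>l. ennreal (loop_energy chi l)) \<in> borel_measurable ?\<nu>"
    by (simp cong: measurable_cong_sets)
  have "prob_space.expectation P (\<lambda>\<omega>. exp_neg (pairing (occ_field (L \<omega>)) chi))
      = exp_neg (\<integral>\<^sup>+l. ennreal (1 - exp_neg (ennreal (loop_energy chi l))) \<partial>?\<nu>)"
    using poisson_point_process_laplace[OF L_poisson meas']
    by (simp add: pair cong: Bochner_Integration.integral_cong)
  also have "\<dots> = exp_neg (ennreal (\<alpha> * E))"
    using meas alpha_pos E by (subst nn_integral_scale_measure) (auto simp: ennreal_mult)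
  also have "\<dots> = exp (- E) powr \<alpha>"
    using alpha_pos E by (simp add: exp_neg_ennreal powr_def)
  finally have expectation: "prob_space.expectation P (\<lambda>\<omega>. exp_neg (pairing (occ_field (L \<omega>)) chi))
      = (det M / det M') powr \<alpha>"
    by (simp only: expE)
  have "(det M' / det M) powr (- \<alpha>) = (det M / det M') powr \<alpha>"
    using D by (simp add: powr_minus powr_divide)
  then show ?thesis
    unfolding expectation d1 d2 d3 by simp
qed

end
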